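(* Let $A,B\in\mathbb{M}_m^+$ and let $\|\cdot\|$ be a strictly increasing unitarily invariant norm on $\mathbb{M}_m$. If \[ \big\|(A^{p/2}B^pA^{p/2})^{1/p}\big\|=\big\|(A^{q/2}B^qA^{q/2})^{1/q}\big\| \] for some $0<p<q$, then $AB=BA$.
   Context: $\mathbb{M}_m^+$: positive semidefinite $m\times m$ matrices; powers via functional calculus. A norm is unitarily invariant if $\|UXV\|=\|X\|$ for all unitaries $U,V$, and strictly increasing if for positive semidefinite $A\le B$, $\|A\|=\|B\|$ implies $A=B$. (It is known that $p\mapsto\|(A^{p/2}B^pA^{p/2})^{1/p}\|$ is nondecreasing on $(0,\infty)$.) *)

theory Defs
  imports Complex_Main "Jordan_Normal_Form.Matrix"
begin

definition ctrans :: "complex mat \<Rightarrow> complex mat" where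
  "ctrans A = mat (dim_col A) (dim_row A) (\<lambda>(i,j). cnj (A $$ (j,i)))"

definition unitary_mat :: "nat \<Rightarrow> complex mat \<Rightarrow> bool" where
  "unitary_mat m U \<longleftrightarrow> U \<in> carrier_mat m m \<and> ctrans U * U = 1\<^sub>m m \<and> U * ctrans U = 1\<^sub>m m"

definition psd :: "nat \<Rightarrow> complex mat \<Rightarrow> bool" where
  "psd m A \<longleftrightarrow> A \<in> carrier_mat m m \<and> ctrans A = A \<and>
     (\<forall>v \<in> carrier_vec m. Im (conjugate v \<bullet> (A *\<^sub>v v)) = 0 \<and> 0 \<le> Re (conjugate v \<bullet> (A *\<^sub>v v)))"

definition loewner_le :: "nat \<Rightarrow> complex mat \<Rightarrow> complex mat \<Rightarrow> bool" where
  "loewner_le m A B \<longleftrightarrow> A \<in> carrier_mat m m \<and> B \<in> carrier_mat m m \<and> psd m (B - A)"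

definition mpow :: "nat \<Rightarrow> complex mat \<Rightarrow> real \<Rightarrow> complex mat" where
  "mpow m A r = (SOME X. \<exists>U d. unitary_mat m U \<and> (\<forall>i<m. 0 \<le> d i) \<and>
      A = U * mat_diag m (\<lambda>i. complex_of_real (d i)) * ctrans U \<and>
      X = U * mat_diag m (\<lambda>i. complex_of_real (d i powr r)) * ctrans U)"

definition matrix_norm :: "nat \<Rightarrow> (complex mat \<Rightarrow> real) \<Rightarrow> bool" where
  "matrix_norm m N \<longleftrightarrow>
     (\<forall>X \<in> carrier_mat m m. 0 \<le> N X \<and> (N X = 0 \<longleftrightarrow> X = 0\<^sub>m m m)) \<and>
     (\<forall>X \<in> carrier_mat m m. \<forall>c. N (c \<cdot>\<^sub>m X) = cmod c * N X) \<and>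
     (\<forall>X \<in> carrier_mat m m. \<forall>Y \<in> carrier_mat m m. N (X + Y) \<le> N X + N Y)"

definition unitarily_invariant_norm :: "nat \<Rightarrow> (complex mat \<Rightarrow> real) \<Rightarrow> bool" where
  "unitarily_invariant_norm m N \<longleftrightarrow> matrix_norm m N \<and>
     (\<forall>X \<in> carrier_mat m m. \<forall>U V. unitary_mat m U \<longrightarrow> unitary_mat m V \<longrightarrow> N (U * X * V) = N X)"

definition strictly_increasing_norm :: "nat \<Rightarrow> (complex mat \<Rightarrow> real) \<Rightarrow> bool" where
  "strictly_increasing_norm m N \<longleftrightarrow>
     (\<forall>A B. psd m A \<longrightarrow> psd m B \<longrightarrow> loewner_le m A B \<longrightarrow> N A = N B \<longrightarrow> A = B)"

end

theory Submission
  imports Defs "Jordan_Normal_Form.Spectral_Radius"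
begin

text \<open>
  Let \<open>H t = A powr t * B powr (2 t) * A powr t\<close>, so that the hypothesis concerns \<open>H (p/2)\<close> and \<open>H (q/2)\<close>, and
  let \<open>F k t\<close> be the product of the \<open>k\<close> largest eigenvalues of \<open>H t\<close>. Since
  \<open>det (Z* H Z) \<le> \<lambda>\<^sub>1 \<cdots> \<lambda>\<^sub>k det (Z* Z)\<close> for every \<open>m \<times> k\<close> matrix \<open>Z\<close>, with equality on top eigenvectors,
  these products can be handled like operator norms, without compound matrices. This gives
  \<open>F k ((s + t) / 2)\<^sup>2 \<le> F k s * F k t\<close> and \<open>(F k t)\<^sup>2 \<le> F k (2 t)\<close>, hence Araki's log-majorization
  \<open>F k (p/2) \<le> F k (q/2) powr (p/q)\<close>, and equality here propagates to \<open>(F k (q/4))\<^sup>2 = F k (q/2)\<close>.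

  If the eigenvalues at \<open>p\<close> and \<open>q\<close> differed, log-majorization would leave room to enlarge the smaller
  ones while staying weakly majorized by the larger ones, so a strictly increasing norm would
  strictly increase. Hence equality holds for all \<open>k\<close>, the eigenvalues of \<open>H (q/2)\<close> are the squares of
  those of \<open>H (q/4)\<close>, and comparing traces shows that the commutator of \<open>A powr (q/2)\<close> and \<open>B powr (q/2)\<close>
  has Frobenius norm zero.
\<close>

subsection \<open>Adjoints, unitaries and positive semidefinite matrices\<close>

lemma ctrans_dim[simp]: "dim_row (ctrans A) = dim_col A" "dim_col (ctrans A) = dim_row A"
  by (auto simp: ctrans_def)

lemma ctrans_carrier[simp]: "A \<in> carrier_mat n k \<Longrightarrow> ctrans A \<in> carrier_mat k n"
  by (auto simp: ctrans_def)

lemma ctrans_index[simp]: "i < dim_col A \<Longrightarrow> j < dim_row A \<Longrightarrow> ctrans A $$ (i,j) = cnj (A $$ (j,i))"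
  by (auto simp: ctrans_def)

lemma ctrans_ctrans[simp]: "ctrans (ctrans A) = A"
  by (rule eq_matI) auto

lemma mult_index_sum:
  assumes "i < dim_row A" "j < dim_col B" "dim_col A = dim_row B"
  shows "(A * B) $$ (i,j) = (\<Sum>k<dim_row B. A $$ (i,k) * B $$ (k,j))"
  using assms by (simp add: scalar_prod_def atLeast0LessThan)

lemma ctrans_mult:
  assumes "dim_col A = dim_row B"
  shows "ctrans (A * B) = ctrans B * ctrans A"
  by (rule eq_matI) (use assms in \<open>auto simp: mult_index_sum simp del: index_mult_mat(1) intro!: sum.cong\<close>)

lemma ctrans_one[simp]: "ctrans (1\<^sub>m n) = 1\<^sub>m n"
  by (rule eq_matI) auto

lemma ctrans_mat_diag: "ctrans (mat_diag n f) = mat_diag n (\<lambda>i. cnj (f i))"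
  by (rule eq_matI) (auto simp: mat_diag_def)

lemma ctrans_mat_diag_real[simp]:
  "ctrans (mat_diag n (\<lambda>i. complex_of_real (d i))) = mat_diag n (\<lambda>i. complex_of_real (d i))"
  by (simp add: ctrans_mat_diag)

lemma mat_assoc:
  "dim_col A = dim_row B \<Longrightarrow> dim_col B = dim_row C \<Longrightarrow> (A * B) * C = A * (B * (C :: complex mat))"
  by (metis assoc_mult_mat carrier_matI)

lemma mat_diag_dims[simp]: "dim_row (mat_diag n f) = n" "dim_col (mat_diag n f) = n"
  by (auto simp: mat_diag_def)

lemma unitary_matD:
  assumes "unitary_mat m U"
  shows "U \<in> carrier_mat m m" "ctrans U * U = 1\<^sub>m m" "U * ctrans U = 1\<^sub>m m"
    "dim_row U = m" "dim_col U = m"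
  using assms by (auto simp: unitary_mat_def)

lemma unitary_matI:
  assumes "U \<in> carrier_mat m m" "ctrans U * U = 1\<^sub>m m"
  shows "unitary_mat m U"
  using assms mat_mult_left_right_inverse[of "ctrans U" m U] by (auto simp: unitary_mat_def)

lemma unitary_cancel:
  assumes "unitary_mat m U" "dim_row X = m"
  shows "ctrans U * (U * X) = X" "U * (ctrans U * X) = X"
proof -
  have X: "X \<in> carrier_mat m (dim_col X)" using assms by auto
  show "ctrans U * (U * X) = X" "U * (ctrans U * X) = X"
    using assms X unitary_matD[OF assms(1)]
    by (auto simp flip: mat_assoc)
qed

lemma unitary_cancel_right:
  assumes "unitary_mat m U" "dim_col X = m"
  shows "X * U * ctrans U = X" "X * ctrans U * U = X"
proof -
  have X: "X \<in> carrier_mat (dim_row X) m" using assms by auto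
  show "X * U * ctrans U = X" "X * ctrans U * U = X"
    using assms X unitary_matD[OF assms(1)]
    by (auto simp: mat_assoc)
qed

lemma unitary_ctrans: "unitary_mat m U \<Longrightarrow> unitary_mat m (ctrans U)"
  by (auto simp: unitary_mat_def)

lemma unitary_one: "unitary_mat m (1\<^sub>m m)"
  by (auto simp: unitary_mat_def)

lemma unitary_mult:
  assumes "unitary_mat m U" "unitary_mat m V"
  shows "unitary_mat m (U * V)"
  using assms unitary_matD[OF assms(1)] unitary_matD[OF assms(2)]
  by (intro unitary_matI) (auto simp: ctrans_mult mat_assoc unitary_cancel)

lemma scalar_prod_ctrans:
  assumes "dim_vec v = dim_col Z" "dim_vec w = dim_row Z"
  shows "conjugate v \<bullet> (ctrans Z *\<^sub>v w) = conjugate (Z *\<^sub>v v) \<bullet> w"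
proof -
  have "conjugate v \<bullet> (ctrans Z *\<^sub>v w)
     = (\<Sum>i<dim_col Z. \<Sum>j<dim_row Z. cnj (v $ i) * (cnj (Z $$ (j,i)) * w $ j))"
    using assms by (auto simp: scalar_prod_def sum_distrib_left atLeast0LessThan intro!: sum.cong)
  also have "\<dots> = (\<Sum>j<dim_row Z. \<Sum>i<dim_col Z. cnj (v $ i) * (cnj (Z $$ (j,i)) * w $ j))"
    by (rule sum.swap)
  also have "\<dots> = conjugate (Z *\<^sub>v v) \<bullet> w"
    using assms
    by (auto simp: scalar_prod_def sum_distrib_right sum_distrib_left atLeast0LessThan mult_ac intro!: sum.cong)
  finally show ?thesis .
qed

lemma psd_one: "psd m (1\<^sub>m m)"
proof -
  have "Im (conjugate v \<bullet> v) = 0 \<and> 0 \<le> Re (conjugate v \<bullet> v)" for v :: "complex vec"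
    by (auto simp: scalar_prod_def intro!: sum_nonneg add_nonneg_nonneg)
  then show ?thesis by (auto simp: psd_def)
qed

lemma psdD:
  assumes "psd m H"
  shows "H \<in> carrier_mat m m" "ctrans H = H" "dim_row H = m" "dim_col H = m"
  using assms by (auto simp: psd_def)

lemma psd_congruence:
  assumes "psd m H" "Z \<in> carrier_mat m k"
  shows "psd k (ctrans Z * H * Z)"
proof -
  note H = psdD[OF assms(1)]
  have "conjugate v \<bullet> (ctrans Z * H * Z *\<^sub>v v) = conjugate (Z *\<^sub>v v) \<bullet> (H *\<^sub>v (Z *\<^sub>v v))"
    if v: "v \<in> carrier_vec k" for v
  proof -
    have "ctrans Z * H * Z *\<^sub>v v = ctrans Z *\<^sub>v (H *\<^sub>v (Z *\<^sub>v v))"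
      using H assms v by (simp add: assoc_mult_mat_vec[of _ k m] assoc_mult_mat_vec[of _ k m _ k]
          assoc_mult_mat_vec[of _ m m] mat_assoc)
    then show ?thesis using H assms v by (subst scalar_prod_ctrans[symmetric]) auto
  qed
  moreover have "Z *\<^sub>v v \<in> carrier_vec m" if "v \<in> carrier_vec k" for v
    using assms that by auto
  ultimately show ?thesis
    using H assms by (auto simp: psd_def ctrans_mult mat_assoc)
qed

lemma psd_gram: "Z \<in> carrier_mat m k \<Longrightarrow> psd k (ctrans Z * Z)"
  using psd_congruence[OF psd_one, of Z m k] by (simp add: mat_assoc)

lemma psd_mat_diag:
  assumes "\<And>i. i < m \<Longrightarrow> 0 \<le> d i"
  shows "psd m (mat_diag m (\<lambda>i. complex_of_real (d i)))"
proof -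
  let ?S = "mat_diag m (\<lambda>i. complex_of_real (sqrt (d i)))"
  have "mat_diag m (\<lambda>i. complex_of_real (d i)) = ctrans ?S * ?S"
    using assms by (simp flip: of_real_mult) (auto simp: mat_diag_def intro!: eq_matI)
  then show ?thesis using psd_gram[of ?S m m] by auto
qed

lemma ctrans_mult_self_index:
  assumes "i < dim_col U" "j < dim_col U"
  shows "(ctrans U * U) $$ (i,j) = (\<Sum>l<dim_row U. cnj (U $$ (l,i)) * U $$ (l,j))"
  using assms by (simp add: mult_index_sum del: index_mult_mat(1))

text \<open>Gram-Schmidt on a basis that starts with \<open>v\<close>, then normalisation of every
  column. This lets an eigenvector be split off in the spectral theorem.\<close>

lemma exists_unitary_first_col:
  assumes v: "v \<in> carrier_vec n" "v \<noteq> 0\<^sub>v n"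
  obtains U c where "unitary_mat n U" "c \<noteq> 0" "col U 0 = c \<cdot>\<^sub>v v"
proof -
  interpret cof_vec_space n "TYPE(complex)" .
  define bs where "bs = basis_completion v"
  define ws where "ws = gram_schmidt n bs"
  note bc = basis_completion[OF v, folded bs_def]
  have n: "n > 0" using v by (cases n) auto
  have ws: "corthogonal ws" "set ws \<subseteq> carrier_vec n" "length ws = n"
    using gram_schmidt_result[OF bc(2,4,5) ws_def] bc(6) by auto
  have "bs \<noteq> []" using bc(6) n by auto
  then obtain bs' where bs: "bs = v # bs'" using bc(7) by (cases bs) auto
  have hd: "ws ! 0 = v"
    using gram_schmidt_hd[OF v(1), of bs'] ws n unfolding ws_def bs
    by (metis hd_conv_nth length_greater_0_conv)
  have wsc: "ws ! j \<in> carrier_vec n" if "j < n" for j using ws that by auto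
  define r where "r j = sqrt (\<Sum>l<n. (cmod (ws ! j $ l))\<^sup>2)" for j
  have ip: "(\<Sum>l<n. cnj (ws ! i $ l) * ws ! j $ l) = (if i = j then complex_of_real ((r j)\<^sup>2) else 0)"
    if ij: "i < n" "j < n" for i j
  proof (cases "i = j")
    case True
    have "complex_of_real ((r j)\<^sup>2) = (\<Sum>l<n. complex_of_real ((cmod (ws ! j $ l))\<^sup>2))"
      unfolding r_def by (subst real_sqrt_pow2) (auto intro: sum_nonneg)
    also have "\<dots> = (\<Sum>l<n. cnj (ws ! i $ l) * ws ! j $ l)"
      by (intro sum.cong refl) (simp add: True complex_norm_square mult.commute del: of_real_power)
    finally show ?thesis using True by simp
  next
    case False
    then have "ws ! j \<bullet>c ws ! i = 0"
      using corthogonalD[OF ws(1), of j i] ij ws(3) by auto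
    then show ?thesis using False wsc[OF ij(1)] 
      by (simp add: scalar_prod_def atLeast0LessThan mult.commute)
  qed
  have r0: "r j \<noteq> 0" if j: "j < n" for j
  proof
    assume "r j = 0"
    then have "(\<Sum>l<n. ws ! j $ l * cnj (ws ! j $ l)) = 0" using ip[OF j j] by (simp add: mult.commute)
    then have "ws ! j \<bullet>c ws ! j = 0" using wsc[OF j] by (simp add: scalar_prod_def atLeast0LessThan)
    then show False using corthogonalD[OF ws(1), of j j] j ws(3) by auto
  qed
  define U where "U = mat n n (\<lambda>(l,j). ws ! j $ l / complex_of_real (r j))"
  have "unitary_mat n U"
  proof (rule unitary_matI)
    show "U \<in> carrier_mat n n" by (simp add: U_def)
    show "ctrans U * U = 1\<^sub>m n"
    proof (rule eq_matI)
      fix i j assume ij: "i < dim_row (1\<^sub>m n)" "j < dim_col (1\<^sub>m n)"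
      then have ij: "i < n" "j < n" by auto
      have "(ctrans U * U) $$ (i,j) = (\<Sum>l<n. cnj (ws ! i $ l) * ws ! j $ l) / (r i * r j)"
        using ij by (subst ctrans_mult_self_index) (auto simp: U_def sum_divide_distrib)
      then show "(ctrans U * U) $$ (i,j) = 1\<^sub>m n $$ (i,j)"
        using ij r0[OF ij(2)] by (auto simp: ip power2_eq_square)
    qed (auto simp: U_def)
  qed
  moreover have "col U 0 = (1 / complex_of_real (r 0)) \<cdot>\<^sub>v v"
    using n v hd by (intro eq_vecI) (auto simp: U_def)
  moreover have "1 / complex_of_real (r 0) \<noteq> 0" using r0[OF n] by auto
  ultimately show ?thesis using that by blast
qed

subsection \<open>Spectral decomposition and powers\<close>

abbreviation dmat :: "nat \<Rightarrow> (nat \<Rightarrow> real) \<Rightarrow> complex mat" where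
  "dmat m d \<equiv> mat_diag m (\<lambda>i. complex_of_real (d i))"

definition spectral_dec :: "nat \<Rightarrow> complex mat \<Rightarrow> complex mat \<Rightarrow> (nat \<Rightarrow> real) \<Rightarrow> bool" where
  "spectral_dec m H U d \<longleftrightarrow> unitary_mat m U \<and> (\<forall>i<m. 0 \<le> d i) \<and> H = U * dmat m d * ctrans U"

lemma spectral_index:
  assumes "U \<in> carrier_mat n m" "i < n" "j < n"
  shows "(U * mat_diag m f * ctrans U) $$ (i,j) = (\<Sum>k<m. U $$ (i,k) * f k * cnj (U $$ (j,k)))"
  using assms
  by (subst mat_diag_mult_right[of _ n]) (auto simp: mult_index_sum simp del: index_mult_mat(1))

lemma psd_diag:
  assumes "psd m H" "i < m"
  shows "H $$ (i,i) = complex_of_real (Re (H $$ (i,i)))" "0 \<le> Re (H $$ (i,i))"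
proof -
  note H = psdD[OF assms(1)]
  have u: "unit_vec m i \<in> carrier_vec m" by simp
  have "conjugate (unit_vec m i) = (unit_vec m i :: complex vec)" by (rule eq_vecI) (auto simp: unit_vec_def)
  then have "conjugate (unit_vec m i) \<bullet> (H *\<^sub>v unit_vec m i) = H $$ (i,i)"
    using H assms(2) by simp
  then have "Im (H $$ (i,i)) = 0" "0 \<le> Re (H $$ (i,i))"
    using assms(1) u unfolding psd_def by metis+
  then show "H $$ (i,i) = complex_of_real (Re (H $$ (i,i)))" "0 \<le> Re (H $$ (i,i))"
    by (auto simp: complex_eq_iff)
qed

text \<open>Deflation: in a unitary basis that starts with an eigenvector, the first column is a
  multiple of the first unit vector, Hermitian symmetry clears the first row, and the remaining
  block is again positive semidefinite.\<close>

theorem psd_spectral: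
  assumes "psd m H"
  obtains U d where "spectral_dec m H U d"
proof -
  have "\<exists>U d. spectral_dec m H U d" using assms
  proof (induction m arbitrary: H)
    case 0
    have "spectral_dec 0 H (1\<^sub>m 0) (\<lambda>_. 0)"
      unfolding spectral_dec_def
      by (intro conjI unitary_one eq_matI) (use psdD[OF 0] in auto)
    then show ?case by blast
  next
    case (Suc n)
    let ?m = "Suc n"
    note H = psdD[OF Suc.prems]
    obtain e v where ev: "eigenvector H v e"
      using spectrum_non_empty[of H ?m] H by (auto simp: spectrum_def eigenvalue_def)
    then have v: "v \<in> carrier_vec ?m" "v \<noteq> 0\<^sub>v ?m" "H *\<^sub>v v = e \<cdot>\<^sub>v v"
      using H by (auto simp: eigenvector_def)
    obtain U c where U: "unitary_mat ?m U" "c \<noteq> 0" "col U 0 = c \<cdot>\<^sub>v v"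
      using exists_unitary_first_col[OF v(1,2)] by blast
    note Uc = unitary_matD[OF U(1)]
    define G where "G = ctrans U * H * U"
    have G: "psd ?m G" unfolding G_def by (rule psd_congruence) (use Suc.prems Uc in auto)
    have HG: "H = U * G * ctrans U"
      unfolding G_def using U Uc H by (simp add: mat_assoc unitary_cancel)
    have cU: "col U 0 \<in> carrier_vec ?m" by (rule carrier_vecI) (simp add: Uc(4))
    have "col G 0 = col (ctrans U * (H * U)) 0"
      unfolding G_def using Uc H by (simp add: mat_assoc)
    also have "\<dots> = ctrans U *\<^sub>v col (H * U) 0"
      by (rule col_mult2[of _ ?m ?m _ ?m]) (use Uc(1) H(1) in auto)
    also have "col (H * U) 0 = H *\<^sub>v col U 0"
      by (rule col_mult2[of _ ?m ?m _ ?m]) (use Uc(1) H(1) in auto)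
    also have "H *\<^sub>v col U 0 = e \<cdot>\<^sub>v col U 0"
      using H v by (simp add: U(3) mult_mat_vec[of _ ?m ?m] smult_smult_assoc mult.commute)
    also have "ctrans U *\<^sub>v (e \<cdot>\<^sub>v col U 0) = e \<cdot>\<^sub>v (ctrans U *\<^sub>v col U 0)"
      by (rule mult_mat_vec[OF ctrans_carrier[OF Uc(1)] cU])
    also have "ctrans U *\<^sub>v col U 0 = col (ctrans U * U) 0"
      by (rule col_mult2[OF ctrans_carrier[OF Uc(1)] Uc(1), symmetric]) simp
    finally have col: "col G 0 = e \<cdot>\<^sub>v unit_vec ?m 0" using Uc by simp
    have G0: "G $$ (i,0) = (if i = 0 then e else 0)" if "i < ?m" for i
    proof -
      have "G $$ (i,0) = col G 0 $ i" using psdD[OF G] that by simp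
      then show ?thesis using that by (simp add: col)
    qed
    have G0': "G $$ (0,i) = (if i = 0 then e else 0)" if "i < ?m" for i
    proof -
      have "G $$ (0,i) = cnj (G $$ (i,0))"
        using psdD[OF G] that by (metis ctrans_index zero_less_Suc)
      moreover have "cnj e = e" using psd_diag(1)[OF G, of 0] G0[of 0] by (metis complex_cnj_complex_of_real zero_less_Suc)
      ultimately show ?thesis using G0[OF that] by auto
    qed
    \<comment> \<open>\<open>E\<close> embeds the last \<open>n\<close> coordinates, so the lower
      block \<open>K\<close> is a congruence of \<open>G\<close> and inherits
      semidefiniteness.\<close>
    define E where "E = mat ?m n (\<lambda>(i,j). if i = Suc j then 1 else 0 :: complex)"
    define K where "K = mat n n (\<lambda>(i,j). G $$ (Suc i, Suc j))"
    have E: "E \<in> carrier_mat ?m n" by (simp add: E_def)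
    have "K = ctrans E * G * E"
    proof (rule eq_matI)
      fix i j assume "i < dim_row (ctrans E * G * E)" "j < dim_col (ctrans E * G * E)"
      then have ij: "i < n" "j < n" using E by auto
      have "(G * E) $$ (l,j) = G $$ (l, Suc j)" if "l < ?m" for l
        using ij that psdD[OF G] E
        by (simp add: mult_index_sum E_def if_distrib sum.delta cong: if_cong del: index_mult_mat(1))
      then have "(ctrans E * (G * E)) $$ (i,j) = (\<Sum>l<?m. (if l = Suc i then 1 else 0) * G $$ (l, Suc j))"
        using ij psdD[OF G] E
        by (subst mult_index_sum) (auto simp: E_def simp del: index_mult_mat(1) intro!: sum.cong)
      also have "\<dots> = G $$ (Suc i, Suc j)" using ij by (simp add: if_distrib[of "\<lambda>x. x * _"] sum.delta cong: if_cong)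
      finally show "K $$ (i,j) = (ctrans E * G * E) $$ (i,j)"
        using ij psdD[OF G] E by (simp add: mat_assoc K_def)
    qed (use E in \<open>auto simp: K_def\<close>)
    then have "psd n K" using psd_congruence[OF G E] by simp
    then obtain W d where W: "spectral_dec n K W d" using Suc.IH by blast
    \<comment> \<open>\<open>V\<close> is the block sum of 1 and \<open>W\<close>: it fixes the
      direction already split off and diagonalises the rest.\<close>
    define V where "V = mat ?m ?m (\<lambda>(i,j). if i = 0 \<or> j = 0 then (if i = j then 1 else 0) else W $$ (i-1,j-1))"
    define d' where "d' = case_nat (Re e) d"
    have Wu: "unitary_mat n W" "\<forall>i<n. 0 \<le> d i" "K = W * dmat n d * ctrans W"
      using W by (auto simp: spectral_dec_def)
    note Wc = unitary_matD[OF Wu(1)]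
    have V: "V \<in> carrier_mat ?m ?m" by (simp add: V_def)
    have Vu: "unitary_mat ?m V"
    proof (rule unitary_matI[OF V], rule eq_matI)
      fix i j assume "i < dim_row (1\<^sub>m ?m)" "j < dim_col (1\<^sub>m ?m)"
      then have ij: "i < ?m" "j < ?m" by auto
      have *: "(\<Sum>l<n. cnj (W $$ (l,a)) * W $$ (l,b)) = (if a = b then 1 else 0)" if "a < n" "b < n" for a b
        using ctrans_mult_self_index[of a W b] Wc that by simp
      have "(ctrans V * V) $$ (i,j) = (\<Sum>l<?m. cnj (V $$ (l,i)) * V $$ (l,j))"
        using ij V by (subst ctrans_mult_self_index) auto
      also have "\<dots> = (if i = j then 1 else 0)"
        using ij * by (subst sum.lessThan_Suc_shift) (cases i; cases j; auto simp: V_def)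
      finally show "(ctrans V * V) $$ (i,j) = 1\<^sub>m ?m $$ (i,j)" using ij by simp
    qed (use V in auto)
    have e: "e = complex_of_real (Re e)" "0 \<le> Re e"
      using psd_diag[OF G, of 0] G0[of 0] by auto
    have "G = V * dmat ?m d' * ctrans V"
    proof (rule eq_matI)
      fix i j assume "i < dim_row (V * dmat ?m d' * ctrans V)" "j < dim_col (V * dmat ?m d' * ctrans V)"
      then have ij: "i < ?m" "j < ?m" using V by auto
      have K: "G $$ (Suc a, Suc b) = (\<Sum>k<n. W $$ (a,k) * d k * cnj (W $$ (b,k)))" if "a < n" "b < n" for a b
        using spectral_index[OF Wc(1) that, of d] that by (simp add: K_def flip: Wu(3))
      have "(V * dmat ?m d' * ctrans V) $$ (i,j) = (\<Sum>k<?m. V $$ (i,k) * d' k * cnj (V $$ (j,k)))"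
        using spectral_index[OF V ij] by simp
      also have "\<dots> = G $$ (i,j)"
        using ij K e(1) by (subst sum.lessThan_Suc_shift)
          (cases i; cases j; auto simp: V_def d'_def G0 G0')
      finally show "G $$ (i,j) = (V * dmat ?m d' * ctrans V) $$ (i,j)" by simp
    qed (use V psdD[OF G] in auto)
    then have "H = (U * V) * dmat ?m d' * ctrans (U * V)"
      using HG V Uc by (simp add: ctrans_mult mat_assoc)
    moreover have "\<forall>i<?m. 0 \<le> d' i" using Wu(2) e(2) by (auto simp: d'_def split: nat.splits)
    ultimately have "spectral_dec ?m H (U * V) d'"
      using unitary_mult[OF U(1) Vu] by (simp add: spectral_dec_def)
    then show ?case by blast
  qed
  then show ?thesis using that by blast
qed

lemma spectral_dec_psd: "spectral_dec m H U d \<Longrightarrow> psd m H"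
  using psd_congruence[OF psd_mat_diag, of m d "ctrans U" m]
  by (auto simp: spectral_dec_def unitary_mat_def)

text \<open>Serves twice: to sort eigenvalues, and to exchange two entries of a diagonal matrix by a
  unitary.\<close>

lemma spectral_dec_permute:
  assumes "spectral_dec m H U d" "bij_betw \<sigma> {..<m} {..<m}"
  shows "spectral_dec m H (mat m m (\<lambda>(i,j). U $$ (i, \<sigma> j))) (d \<circ> \<sigma>)" (is "spectral_dec m H ?V _")
proof -
  have U: "unitary_mat m U" "\<forall>i<m. 0 \<le> d i" "H = U * dmat m d * ctrans U"
    using assms(1) by (auto simp: spectral_dec_def)
  note Uc = unitary_matD[OF U(1)]
  have \<sigma>: "\<sigma> i < m" if "i < m" for i using assms(2) that by (auto simp: bij_betw_def)
  have inj: "\<sigma> i = \<sigma> j \<longleftrightarrow> i = j" if "i < m" "j < m" for i j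
    using assms(2) that by (auto simp: bij_betw_def inj_on_def)
  have V: "?V \<in> carrier_mat m m" by simp
  have "unitary_mat m ?V"
  proof (rule unitary_matI[OF V], rule eq_matI)
    fix i j assume "i < dim_row (1\<^sub>m m)" "j < dim_col (1\<^sub>m m)"
    then have ij: "i < m" "j < m" by auto
    have "(ctrans ?V * ?V) $$ (i,j) = (ctrans U * U) $$ (\<sigma> i, \<sigma> j)"
      using ij \<sigma> Uc by (subst (1 2) ctrans_mult_self_index) auto
    then show "(ctrans ?V * ?V) $$ (i,j) = 1\<^sub>m m $$ (i,j)"
      using Uc ij \<sigma> inj by simp
  qed auto
  moreover have "H = ?V * dmat m (d \<circ> \<sigma>) * ctrans ?V"
  proof (rule eq_matI)
    fix i j assume "i < dim_row (?V * dmat m (d \<circ> \<sigma>) * ctrans ?V)" "j < dim_col (?V * dmat m (d \<circ> \<sigma>) * ctrans ?V)"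
    then have ij: "i < m" "j < m" by auto
    have "H $$ (i,j) = (\<Sum>k<m. U $$ (i,k) * d k * cnj (U $$ (j,k)))"
      unfolding U(3) using spectral_index[OF Uc(1) ij] .
    also have "\<dots> = (\<Sum>k<m. U $$ (i,\<sigma> k) * d (\<sigma> k) * cnj (U $$ (j,\<sigma> k)))"
      by (rule sum.reindex_bij_betw[OF assms(2), symmetric])
    also have "\<dots> = (?V * dmat m (d \<circ> \<sigma>) * ctrans ?V) $$ (i,j)"
      using ij by (subst spectral_index[OF V]) auto
    finally show "H $$ (i,j) = (?V * dmat m (d \<circ> \<sigma>) * ctrans ?V) $$ (i,j)" .
  qed (use U(3) Uc in auto)
  ultimately show ?thesis using U(2) \<sigma> by (auto simp: spectral_dec_def)
qed

definition sorted_dec :: "nat \<Rightarrow> complex mat \<Rightarrow> complex mat \<Rightarrow> (nat \<Rightarrow> real) \<Rightarrow> bool" where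
  "sorted_dec m H U d \<longleftrightarrow> spectral_dec m H U d \<and> antimono_on {..<m} d"

lemma exists_sorting_permutation:
  fixes d :: "nat \<Rightarrow> real"
  obtains \<sigma> where "bij_betw \<sigma> {..<m} {..<m}" "antimono_on {..<m} (d \<circ> \<sigma>)"
proof -
  define xs where "xs = sort_key (\<lambda>i. - d i) [0..<m]"
  have len: "length xs = m" and set: "set xs = {..<m}" and dist: "distinct xs"
    by (auto simp: xs_def)
  have "bij_betw ((!) xs) {..<m} {..<m}"
    by (rule bij_betw_nth[OF dist]) (simp_all add: len set)
  moreover have "sorted (map (\<lambda>i. - d i) xs)" by (simp add: xs_def)
  then have "antimono_on {..<m} (d \<circ> (!) xs)"
    unfolding monotone_on_def using sorted_nth_mono[of "map (\<lambda>i. - d i) xs"] len by simp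
  ultimately show ?thesis using that by blast
qed

lemma psd_sorted_dec:
  assumes "psd m H"
  obtains U d where "sorted_dec m H U d"
proof -
  obtain U d where "spectral_dec m H U d" using psd_spectral[OF assms] .
  moreover obtain \<sigma> where "bij_betw \<sigma> {..<m} {..<m}" "antimono_on {..<m} (d \<circ> \<sigma>)"
    using exists_sorting_permutation .
  ultimately show ?thesis using that spectral_dec_permute unfolding sorted_dec_def by blast
qed

text \<open>In the two eigenbases the hypothesis says that the entry of \<open>W\<close> at (i,j) is
  zero unless \<open>d i = e j\<close>; either way \<open>f\<close> may be applied on both sides.
  With \<open>X\<close> the identity this makes powers well defined; with equal decompositions it
  makes powers commute with whatever commutes with the matrix.\<close>

lemma spectral_intertwine:
  assumes U: "unitary_mat m U" and V: "unitary_mat m V" and X: "X \<in> carrier_mat m m"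
    and eq: "U * dmat m d * ctrans U * X = X * (V * dmat m e * ctrans V)"
  shows "U * dmat m (f \<circ> d) * ctrans U * X = X * (V * dmat m (f \<circ> e) * ctrans V)"
proof -
  note Uc = unitary_matD[OF U] note Vc = unitary_matD[OF V]
  define W where "W = ctrans U * X * V"
  have W: "W \<in> carrier_mat m m" using Uc Vc X by (auto simp: W_def)
  have XW: "X = U * W * ctrans V"
    using U V Uc Vc X by (simp add: W_def mat_assoc unitary_cancel)
  have "dmat m d * W = ctrans U * (U * dmat m d * ctrans U * X) * V"
    using U V Uc Vc X W by (simp add: W_def mat_assoc unitary_cancel)
  also have "\<dots> = W * dmat m e"
    using U V Uc Vc X W by (simp add: eq) (simp add: W_def mat_assoc unitary_cancel)
  finally have *: "dmat m d * W = W * dmat m e" .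
  have "dmat m (f \<circ> d) * W = W * dmat m (f \<circ> e)"
  proof (rule eq_matI)
    fix i j assume "i < dim_row (W * dmat m (f \<circ> e))" "j < dim_col (W * dmat m (f \<circ> e))"
    then have ij: "i < m" "j < m" using W by auto
    have "(dmat m d * W) $$ (i,j) = (W * dmat m e) $$ (i,j)" using * by simp
    then have "d i * W $$ (i,j) = W $$ (i,j) * e j"
      using ij by (simp add: mat_diag_mult_left[OF W] mat_diag_mult_right[OF W])
    then have "W $$ (i,j) = 0 \<or> d i = e j" by auto
    then show "(dmat m (f \<circ> d) * W) $$ (i,j) = (W * dmat m (f \<circ> e)) $$ (i,j)"
      using ij by (auto simp: mat_diag_mult_left[OF W] mat_diag_mult_right[OF W])
  qed (use W in auto)
  then have "U * (dmat m (f \<circ> d) * W) * ctrans V = U * (W * dmat m (f \<circ> e)) * ctrans V" by simp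
  then show ?thesis
    using U V Uc Vc W unfolding XW by (simp add: mat_assoc unitary_cancel)
qed

text \<open>\<open>mpow\<close> picks an arbitrary decomposition; intertwining two of them with the
  identity shows that every choice gives the same matrix.\<close>

lemma mpow_eq:
  assumes "spectral_dec m A U d"
  shows "mpow m A r = U * dmat m (\<lambda>i. d i powr r) * ctrans U"
proof -
  have U: "unitary_mat m U" "\<forall>i<m. 0 \<le> d i" "A = U * dmat m d * ctrans U"
    using assms by (auto simp: spectral_dec_def)
  note Uc = unitary_matD[OF U(1)]
  show ?thesis unfolding mpow_def
  proof (rule someI2)
    show "\<exists>U' d'. unitary_mat m U' \<and> (\<forall>i<m. 0 \<le> d' i) \<and> A = U' * dmat m d' * ctrans U' \<and>
      U * dmat m (\<lambda>i. d i powr r) * ctrans U = U' * dmat m (\<lambda>i. d' i powr r) * ctrans U'"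
      using U by blast
  next
    fix X assume "\<exists>U' d'. unitary_mat m U' \<and> (\<forall>i<m. 0 \<le> d' i) \<and> A = U' * dmat m d' * ctrans U' \<and>
      X = U' * dmat m (\<lambda>i. d' i powr r) * ctrans U'"
    then obtain V e where V: "unitary_mat m V" "A = V * dmat m e * ctrans V"
      "X = V * dmat m (\<lambda>i. e i powr r) * ctrans V" by blast
    note Vc = unitary_matD[OF V(1)]
    have "V * dmat m e * ctrans V * 1\<^sub>m m = 1\<^sub>m m * (U * dmat m d * ctrans U)"
      using U V Uc Vc by simp
    from spectral_intertwine[OF V(1) U(1) _ this, of "\<lambda>x. x powr r"]
    show "X = U * dmat m (\<lambda>i. d i powr r) * ctrans U"
      using U V Uc Vc by (simp add: o_def)
  qed
qed

lemma spectral_dec_mpow: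
  assumes "spectral_dec m A U d"
  shows "spectral_dec m (mpow m A r) U (\<lambda>i. d i powr r)"
  using assms by (simp add: mpow_eq[OF assms]) (simp add: spectral_dec_def)

lemma psd_mpow: "psd m A \<Longrightarrow> psd m (mpow m A r)"
  by (meson psd_spectral spectral_dec_mpow spectral_dec_psd)

lemma mpow_mpow:
  assumes "psd m A"
  shows "mpow m (mpow m A r) s = mpow m A (r * s)"
proof -
  obtain U d where U: "spectral_dec m A U d" using psd_spectral[OF assms] .
  show ?thesis
    using mpow_eq[OF spectral_dec_mpow[OF U]] mpow_eq[OF U] by (simp add: powr_powr)
qed

lemma mpow_one:
  assumes "psd m A"
  shows "mpow m A 1 = A"
proof -
  obtain U d where U: "spectral_dec m A U d" using psd_spectral[OF assms] .
  then have "dmat m (\<lambda>i. d i powr 1) = dmat m d"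
    by (auto simp: spectral_dec_def mat_diag_def intro!: eq_matI)
  then show ?thesis using mpow_eq[OF U, of 1] U by (simp add: spectral_dec_def)
qed

text \<open>In HOL \<open>0 powr r = 0\<close> for every \<open>r\<close>, also for
  \<open>r = 0\<close>. Hence negative powers are pseudo-inverses, \<open>mpow m A 0\<close> is the
  projection onto the range of \<open>A\<close>, and exponents add for all reals, even when
  \<open>A\<close> is singular.\<close>

lemma mpow_mult:
  assumes "psd m A"
  shows "mpow m A r * mpow m A s = mpow m A (r + s)"
proof -
  obtain U d where U: "spectral_dec m A U d" using psd_spectral[OF assms] .
  then have Uu: "unitary_mat m U" by (simp add: spectral_dec_def)
  have "U * D * ctrans U * (U * E * ctrans U) = U * (D * E) * ctrans U"
    if "D \<in> carrier_mat m m" "E \<in> carrier_mat m m" for D E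
    using Uu unitary_matD[OF Uu] that by (simp add: mat_assoc unitary_cancel)
  then show ?thesis
    by (simp add: mpow_eq[OF U] powr_add)
qed

lemma mpow_commute:
  assumes A: "psd m A" and X: "X \<in> carrier_mat m m" and "A * X = X * A"
  shows "mpow m A r * X = X * mpow m A r"
proof -
  obtain U d where U: "spectral_dec m A U d" using psd_spectral[OF assms(1)] .
  then have Uu: "unitary_mat m U" "A = U * dmat m d * ctrans U" by (auto simp: spectral_dec_def)
  show ?thesis
    using spectral_intertwine[OF Uu(1) Uu(1) X assms(3)[unfolded Uu(2)], of "\<lambda>x. x powr r"]
    by (simp add: mpow_eq[OF U] o_def)
qed

subsection \<open>Compressions and determinants\<close>

lemma det_mat_diag: "det (mat_diag m f) = (\<Prod>i<m. f i)"
proof -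
  have "det (mat_diag m f) = prod_list (diag_mat (mat_diag m f))"
    by (rule det_upper_triangular[of _ m]) (auto simp: mat_diag_def)
  then show ?thesis by (simp add: prod_list_diag_prod atLeast0LessThan) (simp add: mat_diag_def)
qed

lemma det_unitary_conj:
  assumes "unitary_mat m U" "X \<in> carrier_mat m m"
  shows "det (U * X * ctrans U) = det X"
proof -
  note Uc = unitary_matD[OF assms(1)]
  have "det U * det (ctrans U) = 1"
    using det_mult[OF Uc(1) ctrans_carrier[OF Uc(1)]] Uc(3) by simp
  moreover have "det (U * X * ctrans U) = det U * det X * det (ctrans U)"
    using Uc(1) assms(2) by (simp add: det_mult[of _ m])
  ultimately show ?thesis by (simp add: algebra_simps)
qed

lemma det_spectral:
  assumes "spectral_dec m H U d"
  shows "det H = complex_of_real (\<Prod>i<m. d i)"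
  using assms by (auto simp: spectral_dec_def det_unitary_conj det_mat_diag)

lemma det_psd:
  assumes "psd m H"
  shows "det H = complex_of_real (Re (det H))" "0 \<le> Re (det H)"
proof -
  obtain U d where U: "spectral_dec m H U d" using psd_spectral[OF assms] .
  then have "0 \<le> (\<Prod>i<m. d i)" by (auto simp: spectral_dec_def intro!: prod_nonneg)
  then show "det H = complex_of_real (Re (det H))" "0 \<le> Re (det H)"
    by (simp_all add: det_spectral[OF U] del: of_real_prod)
qed

lemma gram_diag_index:
  assumes "Z \<in> carrier_mat m n" "i < n"
  shows "(ctrans Z * dmat m e * Z) $$ (i,i) = complex_of_real (\<Sum>l<m. e l * (cmod (Z $$ (l,i)))\<^sup>2)"
proof -
  have "(ctrans Z * dmat m e * Z) $$ (i,i) = (\<Sum>l<m. cnj (Z $$ (l,i)) * e l * Z $$ (l,i))"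
    using spectral_index[of "ctrans Z" n m i i] assms by simp
  also have "\<dots> = (\<Sum>l<m. complex_of_real (e l * (cmod (Z $$ (l,i)))\<^sup>2))"
    by (intro sum.cong refl) (simp add: complex_norm_square mult_ac del: of_real_power)
  finally show ?thesis by simp
qed

lemma gram_index:
  assumes "Z \<in> carrier_mat m n" "i < n"
  shows "(ctrans Z * Z) $$ (i,i) = complex_of_real (\<Sum>l<m. (cmod (Z $$ (l,i)))\<^sup>2)"
proof -
  have "ctrans Z * dmat m (\<lambda>_. 1) * Z = ctrans Z * Z" using assms by simp
  then show ?thesis using gram_diag_index[OF assms, of "\<lambda>_. 1"] by simp
qed

text \<open>There are \<open>j + 1\<close> unknowns against \<open>j\<close> homogeneous
  equations.\<close>

lemma exists_kernel_vector:
  fixes Y :: "complex mat"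
  assumes "Y \<in> carrier_mat m k" "j < k" "j < m"
  obtains C where "C \<in> carrier_mat k 1" "\<And>i. j < i \<Longrightarrow> i < k \<Longrightarrow> C $$ (i,0) = 0"
    "\<exists>i<k. C $$ (i,0) \<noteq> 0" "\<And>l. l < j \<Longrightarrow> (Y * C) $$ (l,0) = 0"
proof -
  \<comment> \<open>The \<open>j\<close> equations are padded with a zero row to a square matrix, so
    that a vanishing determinant supplies the solution.\<close>
  define T where "T = mat (Suc j) (Suc j) (\<lambda>(l,i). if l < j then Y $$ (l,i) else 0)"
  have T: "T \<in> carrier_mat (Suc j) (Suc j)" by (simp add: T_def)
  have "transpose_mat T *\<^sub>v unit_vec (Suc j) j = 0\<^sub>v (Suc j)"
    by (rule eq_vecI) (auto simp: T_def)
  then have "det (transpose_mat T) = 0"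
    using T det_0_iff_vec_prod_zero[of "transpose_mat T" "Suc j"] unit_vec_carrier[of "Suc j" j]
      unit_vec_nonzero[of j "Suc j"] by (metis lessI transpose_carrier_mat)
  then have "det T = 0" by (simp add: det_transpose[OF T])
  then obtain c where c: "c \<in> carrier_vec (Suc j)" "c \<noteq> 0\<^sub>v (Suc j)" "T *\<^sub>v c = 0\<^sub>v (Suc j)"
    using det_0_iff_vec_prod_zero[OF T] by auto
  define C where "C = mat k 1 (\<lambda>(i,_). if i \<le> j then c $ i else 0)"
  have C: "C \<in> carrier_mat k 1" by (simp add: C_def)
  moreover have "C $$ (i,0) = 0" if "j < i" "i < k" for i using that by (simp add: C_def)
  moreover have "\<exists>i<k. C $$ (i,0) \<noteq> 0"
  proof -
    obtain i where "i < Suc j" "c $ i \<noteq> 0" using c(1,2)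
      by (metis carrier_vecD eq_vecI index_zero_vec(1) index_zero_vec(2))
    then show ?thesis using assms(2) by (auto simp: C_def intro!: exI[of _ i])
  qed
  moreover have "(Y * C) $$ (l,0) = 0" if l: "l < j" for l
  proof -
    have "(Y * C) $$ (l,0) = (\<Sum>i<k. Y $$ (l,i) * C $$ (i,0))"
      using assms C l by (subst mult_index_sum) auto
    also have "\<dots> = (\<Sum>i<Suc j. Y $$ (l,i) * c $ i)"
      using assms(2) by (intro sum.mono_neutral_cong_right) (auto simp: C_def)
    also have "\<dots> = (T *\<^sub>v c) $ l"
      using c(1) l by (simp add: T_def scalar_prod_def atLeast0LessThan)
    finally show ?thesis using c(3) l by simp
  qed
  ultimately show ?thesis using that by blast
qed

text \<open>Courant-Fischer: some nonzero combination of the first \<open>j + 1\<close> columns of \<open>Y\<close> vanishes in its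
  first \<open>j\<close> coordinates.\<close>

lemma compression_eigenvalue_le:
  assumes Y: "Y \<in> carrier_mat m k" "ctrans Y * Y = 1\<^sub>m k"
    and D: "ctrans Y * dmat m d * Y = dmat k \<mu>"
    and mono: "antimono_on {..<m} d" "antimono_on {..<k} \<mu>" and j: "j < k" "k \<le> m"
  shows "\<mu> j \<le> d j"
proof -
  have jm: "j < m" using j by simp
  obtain C where C: "C \<in> carrier_mat k 1" "\<And>i. j < i \<Longrightarrow> i < k \<Longrightarrow> C $$ (i,0) = 0"
    "\<exists>i<k. C $$ (i,0) \<noteq> 0" "\<And>l. l < j \<Longrightarrow> (Y * C) $$ (l,0) = 0"
    using exists_kernel_vector[OF Y(1) j(1) jm] by blast
  \<comment> \<open>\<open>C\<close> holds coefficients, and \<open>Y * C\<close> is the resulting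
    vector. Since \<open>Y\<close> is an isometry, both have the same squared length (fact
    \<open>n\<close>), and their diagonal quadratic forms agree (fact \<open>d\<close>).\<close>
  let ?c = "\<lambda>i. (cmod (C $$ (i,0)))\<^sup>2" and ?x = "\<lambda>l. (cmod ((Y * C) $$ (l,0)))\<^sup>2"
  have X: "Y * C \<in> carrier_mat m 1" using Y C by simp
  have "complex_of_real (\<Sum>l<m. d l * ?x l) = (ctrans (Y * C) * dmat m d * (Y * C)) $$ (0,0)"
    by (rule gram_diag_index[OF X, symmetric]) simp
  also have "ctrans (Y * C) * dmat m d * (Y * C) = ctrans C * (ctrans Y * dmat m d * Y) * C"
    using Y(1) C(1) by (simp add: ctrans_mult mat_assoc)
  also have "\<dots> = ctrans C * dmat k \<mu> * C" by (simp only: D)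
  also have "\<dots> $$ (0,0) = complex_of_real (\<Sum>i<k. \<mu> i * ?c i)"
    by (rule gram_diag_index[OF C(1)]) simp
  finally have d: "(\<Sum>l<m. d l * ?x l) = (\<Sum>i<k. \<mu> i * ?c i)" by (simp only: of_real_eq_iff)
  have "complex_of_real (\<Sum>l<m. ?x l) = (ctrans (Y * C) * (Y * C)) $$ (0,0)"
    by (rule gram_index[OF X, symmetric]) simp
  also have "ctrans (Y * C) * (Y * C) = ctrans C * (ctrans Y * Y) * C"
    using Y(1) C(1) by (simp add: ctrans_mult mat_assoc)
  also have "\<dots> = ctrans C * C" using C(1) by (simp add: Y(2))
  also have "\<dots> $$ (0,0) = complex_of_real (\<Sum>i<k. ?c i)"
    by (rule gram_index[OF C(1)]) simp
  finally have n: "(\<Sum>l<m. ?x l) = (\<Sum>i<k. ?c i)" by (simp only: of_real_eq_iff)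
  obtain i0 where "i0 < k" "C $$ (i0,0) \<noteq> 0" using C(3) by blast
  then have pos: "0 < (\<Sum>i<k. ?c i)" by (intro sum_pos2[of _ i0]) auto
  \<comment> \<open>\<open>C\<close> lives on indices up to \<open>j\<close>, where the values of
    \<mu> are at least \<open>\<mu> j\<close>; \<open>Y * C\<close> lives on indices from
    \<open>j\<close> on, where those of \<open>d\<close> are at most \<open>d j\<close>. The common
    quadratic form lies between the two bounds.\<close>
  have "\<mu> j * (\<Sum>i<k. ?c i) \<le> (\<Sum>i<k. \<mu> i * ?c i)"
    unfolding sum_distrib_left
  proof (rule sum_mono)
    fix i assume i: "i \<in> {..<k}"
    show "\<mu> j * ?c i \<le> \<mu> i * ?c i"
    proof (cases "i \<le> j")
      case True
      then have "\<mu> j \<le> \<mu> i" using mono(2) i j by (auto simp: monotone_on_def)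
      then show ?thesis by (simp add: mult_right_mono)
    qed (use C(2) i in auto)
  qed
  also have "\<dots> = (\<Sum>l<m. d l * ?x l)" by (simp only: d)
  also have "\<dots> \<le> d j * (\<Sum>l<m. ?x l)"
    unfolding sum_distrib_left
  proof (rule sum_mono)
    fix l assume l: "l \<in> {..<m}"
    show "d l * ?x l \<le> d j * ?x l"
    proof (cases "j \<le> l")
      case True
      then have "d l \<le> d j" using mono(1) l j by (auto simp: monotone_on_def)
      then show ?thesis by (simp add: mult_right_mono)
    qed (use C(4) in auto)
  qed
  finally show ?thesis using pos by (simp add: n)
qed

text \<open>The squared length of \<open>Z w\<close> is the Gram form at \<open>w\<close>, so the
  Gram matrix and \<open>Z\<close> have the same kernel.\<close>

lemma gram_singular_kernel:
  assumes Z: "Z \<in> carrier_mat m k" and "det (ctrans Z * Z) = 0"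
  obtains w where "w \<in> carrier_vec k" "w \<noteq> 0\<^sub>v k" "Z *\<^sub>v w = 0\<^sub>v m"
proof -
  have G: "ctrans Z * Z \<in> carrier_mat k k" using Z by (metis ctrans_carrier mult_carrier_mat)
  obtain w where w: "w \<in> carrier_vec k" "w \<noteq> 0\<^sub>v k" "ctrans Z * Z *\<^sub>v w = 0\<^sub>v k"
    using det_0_iff_vec_prod_zero[OF G] assms(2) by auto
  have Zw: "Z *\<^sub>v w \<in> carrier_vec m" using Z w by simp
  have "conjugate (Z *\<^sub>v w) \<bullet> (Z *\<^sub>v w) = conjugate w \<bullet> (ctrans Z *\<^sub>v (Z *\<^sub>v w))"
    by (rule scalar_prod_ctrans[symmetric]) (use Z w in auto)
  also have "ctrans Z *\<^sub>v (Z *\<^sub>v w) = 0\<^sub>v k"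
    using w(3) assoc_mult_mat_vec[OF ctrans_carrier[OF Z] Z w(1)] by simp
  finally have "conjugate (Z *\<^sub>v w) \<bullet> (Z *\<^sub>v w) = 0" using w(1) by simp
  then have "(Z *\<^sub>v w) \<bullet>c (Z *\<^sub>v w) = 0"
    using comm_scalar_prod[OF carrier_vec_conjugate[OF Zw] Zw] by simp
  then have "Z *\<^sub>v w = 0\<^sub>v m" using conjugate_square_eq_0_vec[OF Zw] by simp
  then show ?thesis using that w by blast
qed

text \<open>If the columns of \<open>Z\<close> are independent, the inverse square root of their
  Gram matrix makes them orthonormal; the compression then has eigenvalues below \<open>d 0\<close>,
  \<open>d 1\<close>, ... one by one, and undoing the normalisation restores the Gram determinant.
  If they are dependent, both determinants vanish.\<close>

lemma det_compression_le:
  assumes H: "sorted_dec m H U d" and Z: "Z \<in> carrier_mat m k" and k: "k \<le> m"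
  shows "Re (det (ctrans Z * H * Z)) \<le> (\<Prod>i<k. d i) * Re (det (ctrans Z * Z))"
proof -
  have U: "unitary_mat m U" "\<forall>i<m. 0 \<le> d i" "H = U * dmat m d * ctrans U" "antimono_on {..<m} d"
    using H by (auto simp: sorted_dec_def spectral_dec_def)
  note Uc = unitary_matD[OF U(1)]
  have Hpsd: "psd m H" using H spectral_dec_psd by (auto simp: sorted_dec_def)
  note Hc = psdD[OF Hpsd]
  define G where "G = ctrans Z * Z"
  have G: "psd k G" unfolding G_def by (rule psd_gram[OF Z])
  define L where "L = ctrans Z * H * Z"
  have L: "psd k L" unfolding L_def by (rule psd_congruence[OF Hpsd Z])
  show ?thesis
  proof (cases "det G = 0")
    case True
    obtain w where w: "w \<in> carrier_vec k" "w \<noteq> 0\<^sub>v k" "Z *\<^sub>v w = 0\<^sub>v m"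
      using gram_singular_kernel[OF Z] True unfolding G_def by blast
    have "L *\<^sub>v w = (ctrans Z * H) *\<^sub>v (Z *\<^sub>v w)"
      unfolding L_def by (rule assoc_mult_mat_vec[of _ k m]) (use Z Hc w in auto)
    also have "\<dots> = 0\<^sub>v k"
      unfolding w(3) by (rule eq_vecI) (use Z Hc(1) in \<open>auto simp: scalar_prod_def\<close>)
    finally have "det L = 0" using det_0_iff_vec_prod_zero[OF psdD(1)[OF L]] w by blast
    then show ?thesis using True by (simp flip: L_def G_def)
  next
    case False
    obtain V g where g: "spectral_dec k G V g" using psd_spectral[OF G] .
    have gpos: "0 < g i" if "i < k" for i
      using g that False det_spectral[OF g] by (fastforce simp: spectral_dec_def less_le)
    define S where "S = mpow k G (-1/2)"
    have S: "psd k S" unfolding S_def by (rule psd_mpow[OF G])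
    note Sc = psdD[OF S] and Gc = psdD[OF G] and Lc = psdD[OF L]
    have Vu: "unitary_mat k V" using g by (simp add: spectral_dec_def)
    have "S * G * S = mpow k G (-1/2) * mpow k G 1 * mpow k G (-1/2)"
      by (simp add: S_def mpow_one[OF G])
    also have "\<dots> = mpow k G 0" by (simp add: mpow_mult[OF G])
    also have "\<dots> = V * dmat k (\<lambda>i. 1) * ctrans V"
    proof -
      have "dmat k (\<lambda>i. g i powr 0) = dmat k (\<lambda>i. 1)"
        using gpos by (fastforce simp: mat_diag_def intro!: eq_matI)
      then show ?thesis by (simp only: mpow_eq[OF g])
    qed
    also have "\<dots> = 1\<^sub>m k" using unitary_matD[OF Vu] by simp
    finally have SGS: "S * G * S = 1\<^sub>m k" .
    define W where "W = Z * S"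
    have W: "W \<in> carrier_mat m k" using Z Sc by (simp add: W_def)
    have "ctrans W * W = S * G * S" using Z Sc by (simp add: W_def G_def ctrans_mult mat_assoc)
    then have WW: "ctrans W * W = 1\<^sub>m k" by (simp only: SGS)
    have WHW: "ctrans W * H * W = S * L * S"
      using Z Sc Hc by (simp add: W_def L_def ctrans_mult mat_assoc)
    have "psd k (S * L * S)" using psd_congruence[OF Hpsd W] WHW by simp
    then obtain Q \<mu> where Q: "sorted_dec k (S * L * S) Q \<mu>" using psd_sorted_dec by blast
    then have Qu: "unitary_mat k Q" "\<forall>i<k. 0 \<le> \<mu> i" "S * L * S = Q * dmat k \<mu> * ctrans Q" "antimono_on {..<k} \<mu>"
      and Qs: "spectral_dec k (S * L * S) Q \<mu>"
      by (auto simp: sorted_dec_def spectral_dec_def)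
    note Qc = unitary_matD[OF Qu(1)]
    \<comment> \<open>\<open>Y\<close> is the orthonormal frame \<open>W\<close>, rotated by the
      eigenvectors \<open>Q\<close> of its compression and written in the eigenbasis of
      \<open>H\<close>; there both quadratic forms are diagonal.\<close>
    define Y where "Y = ctrans U * (W * Q)"
    have Y: "Y \<in> carrier_mat m k" 
      unfolding Y_def by (rule mult_carrier_mat[OF ctrans_carrier[OF Uc(1)] mult_carrier_mat[OF W Qc(1)]])
    have "ctrans Y * Y = ctrans Q * (ctrans W * W) * Q"
      using Uc W Qc U(1) by (simp add: Y_def ctrans_mult mat_assoc unitary_cancel)
    also have "\<dots> = 1\<^sub>m k" using Qc by (simp add: WW)
    finally have YY: "ctrans Y * Y = 1\<^sub>m k" .
    have "ctrans Y * dmat m d * Y = ctrans Q * (ctrans W * H * W) * Q"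
      using Uc W Qc U(1) by (simp add: Y_def U(3) ctrans_mult mat_assoc)
    also have "\<dots> = ctrans Q * (Q * dmat k \<mu> * ctrans Q) * Q"
      by (simp only: WHW Qu(3))
    also have "\<dots> = dmat k \<mu>" using Qu(1) Qc by (simp add: mat_assoc unitary_cancel)
    finally have "ctrans Y * dmat m d * Y = dmat k \<mu>" .
    from compression_eigenvalue_le[OF Y YY this U(4) Qu(4) _ k]
    have "\<mu> i \<le> d i" if "i < k" for i using that by blast
    then have le: "(\<Prod>i<k. \<mu> i) \<le> (\<Prod>i<k. d i)" using Qu(2) by (intro prod_mono) auto
    define s gg l where "s = Re (det S)" and "gg = Re (det G)" and "l = Re (det L)"
    have dets: "det S = of_real s" "det G = of_real gg" "det L = of_real l" "0 \<le> gg"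
      using det_psd[OF S] det_psd[OF G] det_psd[OF L] by (auto simp: s_def gg_def l_def)
    have "det (S * G * S) = of_real (s * gg * s)"
      using Sc(1) Gc(1) by (simp add: det_mult[of _ k] dets)
    then have "of_real (s * gg * s) = (1::complex)" unfolding SGS by simp
    then have 1: "s * gg * s = 1" by (simp only: of_real_eq_1_iff)
    have "det (S * L * S) = of_real (s * l * s)"
      using Sc(1) Lc(1) by (simp add: det_mult[of _ k] dets)
    then have "complex_of_real (s * l * s) = of_real (\<Prod>i<k. \<mu> i)" using det_spectral[OF Qs] by simp
    then have 2: "s * l * s = (\<Prod>i<k. \<mu> i)" by (simp only: of_real_eq_iff)
    \<comment> \<open>Multiplying by \<open>s * gg * s = 1\<close> trades the determinant of
      \<open>L\<close> for that of its normalised form without dividing by \<open>s\<close>.\<close>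
    have "l = (s * gg * s) * l" by (simp add: 1)
    also have "\<dots> = (\<Prod>i<k. \<mu> i) * gg" by (simp add: 2[symmetric])
    also have "\<dots> \<le> (\<Prod>i<k. d i) * gg" using le dets(4) by (rule mult_right_mono)
    finally show ?thesis by (simp add: l_def gg_def L_def G_def)
  qed
qed

subsection \<open>Products of top eigenvalues\<close>

text \<open>The frame consists of the first \<open>k\<close> columns of \<open>U\<close>, cut out by
  a truncated identity. For sorted \<open>d\<close> it attains equality in
  \<open>det_compression_le\<close>.\<close>

lemma top_eigenframe:
  assumes "spectral_dec m H U d" "k \<le> m"
  obtains V where "V \<in> carrier_mat m k" "ctrans V * V = 1\<^sub>m k" "H * V = V * dmat k d"
proof -
  have U: "unitary_mat m U" "H = U * dmat m d * ctrans U"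
    using assms(1) by (auto simp: spectral_dec_def)
  note Uc = unitary_matD[OF U(1)]
  define J where "J = mat m k (\<lambda>(i,j). if i = j then 1 else 0 :: complex)"
  have J: "J \<in> carrier_mat m k" by (simp add: J_def)
  have JJ: "ctrans J * J = 1\<^sub>m k"
  proof (rule eq_matI)
    fix i j assume "i < dim_row (1\<^sub>m k)" "j < dim_col (1\<^sub>m k)"
    then have ij: "i < k" "j < k" by auto
    have "(ctrans J * J) $$ (i,j) = (\<Sum>l<m. cnj (J $$ (l,i)) * J $$ (l,j))"
      using ij J by (subst ctrans_mult_self_index) auto
    also have "\<dots> = (\<Sum>l<m. if l = i then (if i = j then 1 else 0) else 0)"
      using ij by (intro sum.cong refl) (auto simp: J_def)
    also have "\<dots> = 1\<^sub>m k $$ (i,j)" using ij assms(2) by simp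
    finally show "(ctrans J * J) $$ (i,j) = 1\<^sub>m k $$ (i,j)" .
  qed (use J in auto)
  have DJ: "dmat m d * J = J * dmat k d"
    unfolding mat_diag_mult_left[OF J] mat_diag_mult_right[OF J]
    by (rule eq_matI) (auto simp: J_def)
  show ?thesis
  proof
    show "U * J \<in> carrier_mat m k" by (rule mult_carrier_mat[OF Uc(1) J])
    show "ctrans (U * J) * (U * J) = 1\<^sub>m k"
      using Uc J JJ U(1) by (simp add: ctrans_mult mat_assoc unitary_cancel)
    show "H * (U * J) = U * J * dmat k d"
      unfolding U(2) using Uc J U(1) DJ by (simp add: mat_assoc unitary_cancel)
  qed
qed

lemma sorted_decD:
  assumes "sorted_dec m H U d"
  shows "spectral_dec m H U d" "psd m H" "\<And>i. i < m \<Longrightarrow> 0 \<le> d i" "antimono_on {..<m} d"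
  using assms spectral_dec_psd[of m H U d] by (auto simp: sorted_dec_def spectral_dec_def)

lemma sorted_dec_prod_nonneg:
  assumes "sorted_dec m H U d" "k \<le> m"
  shows "0 \<le> (\<Prod>i<k. d i)"
  using sorted_decD(3)[OF assms(1)] assms(2) by (intro prod_nonneg) auto

text \<open>\<open>C\<close> carries eigenvectors of \<open>H\<close> to eigenvectors of \<open>M\<close>, and \<open>K\<close> witnesses that it kills none of
  those with a nonzero eigenvalue; so this bounds eigenvalues of \<open>M\<close> by its singular values.\<close>

lemma top_prod_intertwine_le:
  assumes H: "sorted_dec m H U d" and E: "sorted_dec m (ctrans M * M) W e"
    and c: "M \<in> carrier_mat m m" "C \<in> carrier_mat m m" "K \<in> carrier_mat m m"
    and MC: "M * C = C * H" and KC: "K * C = H" and k: "k \<le> m"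
  shows "(\<Prod>i<k. d i)\<^sup>2 \<le> (\<Prod>i<k. e i)"
proof (cases "(\<Prod>i<k. d i) = 0")
  case True
  show ?thesis using sorted_dec_prod_nonneg[OF E k] unfolding True by simp
next
  case False
  let ?p = "\<Prod>i<k. d i"
  obtain V where V: "V \<in> carrier_mat m k" "ctrans V * V = 1\<^sub>m k" "H * V = V * dmat k d"
    using top_eigenframe[OF sorted_decD(1)[OF H] k] .
  note Hc = psdD[OF sorted_decD(2)[OF H]]
  define Z where "Z = C * V"
  have Z: "Z \<in> carrier_mat m k" unfolding Z_def by (rule mult_carrier_mat[OF c(2) V(1)])
  have G: "psd k (ctrans Z * Z)" by (rule psd_gram[OF Z])
  note Gc = psdD[OF G]
  have MZ: "M * Z = Z * dmat k d"
  proof -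
    have "M * Z = (M * C) * V" using c V by (simp add: Z_def mat_assoc)
    also have "\<dots> = C * (H * V)" using c V Hc by (simp add: MC mat_assoc)
    also have "\<dots> = Z * dmat k d" using c V(1) by (simp add: V(3) Z_def mat_assoc)
    finally show ?thesis .
  qed
  have KZ: "K * Z = V * dmat k d"
  proof -
    have "K * Z = (K * C) * V" using c V by (simp add: Z_def mat_assoc)
    then show ?thesis by (simp add: KC V(3))
  qed
  have det: "det (dmat k d * X * dmat k d) = complex_of_real (?p\<^sup>2) * det X" if "X \<in> carrier_mat k k" for X
    by (simp add: det_mult[OF mult_carrier_mat[OF mat_diag_dim that] mat_diag_dim]
        det_mult[OF mat_diag_dim that] det_mat_diag power2_eq_square)
  have "ctrans Z * (ctrans M * M) * Z = ctrans (M * Z) * (M * Z)"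
    using c Z by (simp add: ctrans_mult mat_assoc)
  also have "\<dots> = dmat k d * (ctrans Z * Z) * dmat k d"
    using Z by (simp add: MZ ctrans_mult mat_assoc)
  finally have 1: "Re (det (ctrans Z * (ctrans M * M) * Z)) = ?p\<^sup>2 * Re (det (ctrans Z * Z))"
    by (simp only: det[OF Gc(1)] times_complex.sel Re_complex_of_real Im_complex_of_real
        mult_zero_left diff_zero)
  \<comment> \<open>The determinant bound for \<open>K\<close> puts a positive number below a
    multiple of the Gram determinant of \<open>Z\<close>, which is therefore nonzero and can be
    cancelled at the end.\<close>
  have "psd m (ctrans K * K)" by (rule psd_gram[OF c(3)])
  then obtain Q f where Q: "sorted_dec m (ctrans K * K) Q f" using psd_sorted_dec by blast
  have "ctrans Z * (ctrans K * K) * Z = ctrans (K * Z) * (K * Z)"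
    using c Z by (simp add: ctrans_mult mat_assoc)
  also have "\<dots> = dmat k d * (ctrans V * V) * dmat k d"
    using V(1) by (simp add: KZ ctrans_mult mat_assoc)
  finally have "Re (det (ctrans Z * (ctrans K * K) * Z)) = ?p\<^sup>2"
    by (simp only: V(2) det[OF one_carrier_mat] times_complex.sel Re_complex_of_real Im_complex_of_real) simp
  then have "?p\<^sup>2 \<le> (\<Prod>i<k. f i) * Re (det (ctrans Z * Z))"
    using det_compression_le[OF Q Z k] by simp
  moreover have "0 < ?p\<^sup>2" using False by simp
  ultimately have "Re (det (ctrans Z * Z)) \<noteq> 0" by auto
  then have pos: "0 < Re (det (ctrans Z * Z))" using det_psd(2)[OF G] by simp
  have "?p\<^sup>2 * Re (det (ctrans Z * Z)) \<le> (\<Prod>i<k. e i) * Re (det (ctrans Z * Z))"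
    using det_compression_le[OF E Z k] 1 by simp
  then show ?thesis using pos by simp
qed

text \<open>Horn's inequality for singular values: with \<open>V\<close> a top eigenframe of the
  product, compress \<open>ctrans X * X\<close> to \<open>Y * V\<close>, then bound the Gram
  determinant of \<open>Y * V\<close> by compressing \<open>ctrans Y * Y\<close> to
  \<open>V\<close>.\<close>

lemma top_prod_mult_le:
  assumes F: "sorted_dec m (ctrans (X * Y) * (X * Y)) U f" and E: "sorted_dec m (ctrans X * X) W e"
    and G: "sorted_dec m (ctrans Y * Y) Q g"
    and c: "X \<in> carrier_mat m m" "Y \<in> carrier_mat m m" and k: "k \<le> m"
  shows "(\<Prod>i<k. f i) \<le> (\<Prod>i<k. e i) * (\<Prod>i<k. g i)"
proof -
  obtain V where V: "V \<in> carrier_mat m k" "ctrans V * V = 1\<^sub>m k"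
    "ctrans (X * Y) * (X * Y) * V = V * dmat k f"
    using top_eigenframe[OF sorted_decD(1)[OF F] k] .
  have YV: "Y * V \<in> carrier_mat m k" by (rule mult_carrier_mat[OF c(2) V(1)])
  have "ctrans (Y * V) * (ctrans X * X) * (Y * V) = ctrans V * (ctrans (X * Y) * (X * Y) * V)"
    using c V(1) by (simp add: ctrans_mult mat_assoc)
  also have "\<dots> = (ctrans V * V) * dmat k f" using V(1) by (simp add: V(3) mat_assoc)
  also have "\<dots> = dmat k f" by (simp add: V(2))
  finally have "(\<Prod>i<k. f i) = Re (det (ctrans (Y * V) * (ctrans X * X) * (Y * V)))"
    by (simp add: det_mat_diag flip: of_real_prod)
  also have "\<dots> \<le> (\<Prod>i<k. e i) * Re (det (ctrans (Y * V) * (Y * V)))"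
    by (rule det_compression_le[OF E YV k])
  also have "ctrans (Y * V) * (Y * V) = ctrans V * (ctrans Y * Y) * V"
    using c V(1) by (simp add: ctrans_mult mat_assoc)
  also have "(\<Prod>i<k. e i) * Re (det \<dots>) \<le> (\<Prod>i<k. e i) * ((\<Prod>i<k. g i) * Re (det (ctrans V * V)))"
    by (rule mult_left_mono[OF det_compression_le[OF G V(1) k] sorted_dec_prod_nonneg[OF E k]])
  finally show ?thesis by (simp add: V(2))
qed

lemma sorted_dec_mpow:
  assumes "sorted_dec m A U d" "0 \<le> r"
  shows "sorted_dec m (mpow m A r) U (\<lambda>i. d i powr r)"
  using assms spectral_dec_mpow[of m A U d r] sorted_decD(3)[OF assms(1)]
  by (auto simp: sorted_dec_def monotone_on_def intro!: powr_mono2)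

lemma prod_powr_nonneg:
  assumes "\<And>i. i \<in> I \<Longrightarrow> 0 \<le> d i"
  shows "(\<Prod>i\<in>I. d i powr r) = (\<Prod>i\<in>I. d i) powr (r::real)"
  using assms
proof (induction I rule: infinite_finite_induct)
  case (insert x F)
  then show ?case by (simp add: powr_mult prod_nonneg)
qed auto

text \<open>\<open>ctrans X\<close> carries eigenvectors of \<open>X * ctrans X\<close> to
  eigenvectors of \<open>ctrans X * X\<close>, and \<open>X\<close> carries them back. The Gram
  matrix of \<open>ctrans X * X\<close> is its square, so the intertwining bound is the claim with
  both sides squared.\<close>

lemma top_prod_swap_le:
  assumes H: "sorted_dec m (X * ctrans X) U d" and E: "sorted_dec m (ctrans X * X) W e"
    and X: "X \<in> carrier_mat m m" and k: "k \<le> m"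
  shows "(\<Prod>i<k. d i) \<le> (\<Prod>i<k. e i)"
proof -
  let ?M = "ctrans X * X"
  have M: "psd m ?M" by (rule psd_gram[OF X])
  note Mc = psdD[OF M]
  have "ctrans ?M * ?M = mpow m ?M 1 * mpow m ?M 1" by (simp add: Mc(2) mpow_one[OF M])
  then have "ctrans ?M * ?M = mpow m ?M 2" by (simp add: mpow_mult[OF M])
  then have "sorted_dec m (ctrans ?M * ?M) W (\<lambda>i. e i powr 2)"
    using sorted_dec_mpow[OF E, of 2] by simp
  from top_prod_intertwine_le[OF H this Mc(1) ctrans_carrier[OF X] X _ _ k]
  have "(\<Prod>i<k. d i)\<^sup>2 \<le> (\<Prod>i<k. e i powr 2)"
    using X by (simp add: mat_assoc)
  also have "\<dots> = (\<Prod>i<k. e i)\<^sup>2"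
    using sorted_decD(3)[OF E] k sorted_dec_prod_nonneg[OF E k]
    by (subst prod_powr_nonneg) (auto simp: powr_numeral)
  finally show ?thesis using sorted_dec_prod_nonneg[OF E k] by (rule power2_le_imp_le)
qed

text \<open>The parameter is half the exponent of the theorem, which makes the matrix the Gram
  matrix of \<open>B powr t * A powr t\<close>.\<close>

definition sandwich :: "nat \<Rightarrow> complex mat \<Rightarrow> complex mat \<Rightarrow> real \<Rightarrow> complex mat" where
  "sandwich m A B t = mpow m A t * mpow m B (2 * t) * mpow m A t"

section \<open>Log-convexity, doubling and boundedness along the sandwich family\<close>

context
  fixes m :: nat and A B :: "complex mat"
  assumes A: "psd m A" and B: "psd m B"
begin

lemma mpow_dims[simp]:
  "dim_row (mpow m A r) = m" "dim_col (mpow m A r) = m" "dim_row (mpow m B r) = m" "dim_col (mpow m B r) = m"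
  "mpow m A r \<in> carrier_mat m m" "mpow m B r \<in> carrier_mat m m"
  "ctrans (mpow m A r) = mpow m A r" "ctrans (mpow m B r) = mpow m B r"
  using psdD[OF psd_mpow[OF A]] psdD[OF psd_mpow[OF B]] by auto

lemma mpow_mult_left:
  assumes "dim_row X = m"
  shows "mpow m A r * (mpow m A s * X) = mpow m A (r + s) * X"
    "mpow m B r * (mpow m B s * X) = mpow m B (r + s) * X"
  using assms by (simp_all add: mpow_mult[OF A] mpow_mult[OF B] flip: mat_assoc)

lemma sandwich_gram: "sandwich m A B t = ctrans (mpow m B t * mpow m A t) * (mpow m B t * mpow m A t)"
  by (simp add: sandwich_def ctrans_mult mat_assoc mpow_mult_left)

lemma sandwich_psd: "psd m (sandwich m A B t)"
  unfolding sandwich_gram by (rule psd_gram) (auto intro!: mult_carrier_mat[of _ m m])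

text \<open>At the midpoint \<open>u\<close>, conjugation by \<open>A powr (s - u)\<close> formally
  turns the sandwich into \<open>?M = A powr s * B powr (2 u) * A powr t\<close>. Its eigenvalue
  products are thus bounded by singular values of \<open>?M\<close>, which factors into
  \<open>ctrans (?Y s)\<close> and \<open>?Y t\<close>.\<close>

lemma sandwich_top_prod_midpoint:
  assumes F: "sorted_dec m (sandwich m A B ((s + t) / 2)) U f"
    and E: "sorted_dec m (sandwich m A B s) W e" and G: "sorted_dec m (sandwich m A B t) Q g"
    and k: "k \<le> m"
  shows "(\<Prod>i<k. f i)\<^sup>2 \<le> (\<Prod>i<k. e i) * (\<Prod>i<k. g i)"
proof -
  define u where "u = (s + t) / 2"
  have t: "t = 2 * u - s" by (simp add: u_def field_simps)
  let ?Y = "\<lambda>t. mpow m B t * mpow m A t"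
  let ?M = "ctrans (?Y s) * ?Y t"
  \<comment> \<open>\<open>?C\<close> equals \<open>A powr (s - u)\<close> times the sandwich at
    \<open>u\<close>. Keeping the sandwich as a factor makes the conjugation legitimate for singular
    \<open>A\<close>; the power \<open>u - s\<close> leads back.\<close>
  let ?C = "mpow m A s * (mpow m B (2 * u) * mpow m A u)"
  have Y: "?Y t \<in> carrier_mat m m" for t by (auto intro!: mult_carrier_mat[of _ m m])
  have M: "?M \<in> carrier_mat m m" using Y by (auto intro!: mult_carrier_mat[of _ m m])
  have C: "?C \<in> carrier_mat m m" by (auto intro!: mult_carrier_mat[of _ m m])
  obtain R h where R: "sorted_dec m (ctrans ?M * ?M) R h"
    using psd_sorted_dec[OF psd_gram[OF M]] .
  have "psd m (?Y s * ctrans (?Y s))" using psd_gram[OF ctrans_carrier[OF Y, of s]] by simp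
  then obtain S l where S: "sorted_dec m (?Y s * ctrans (?Y s)) S l" using psd_sorted_dec by blast
  have MC: "?M * ?C = ?C * sandwich m A B u"
    by (simp add: sandwich_def ctrans_mult mat_assoc mpow_mult_left t)
  have KC: "mpow m A (u - s) * ?C = sandwich m A B u"
    by (simp add: sandwich_def ctrans_mult mat_assoc mpow_mult_left)
  have "(\<Prod>i<k. f i)\<^sup>2 \<le> (\<Prod>i<k. h i)"
    by (rule top_prod_intertwine_le[OF F[folded u_def] R M C _ MC KC k]) simp
  also have "\<dots> \<le> (\<Prod>i<k. l i) * (\<Prod>i<k. g i)"
    by (rule top_prod_mult_le[OF R _ G[unfolded sandwich_gram] ctrans_carrier[OF Y] Y k])
      (use S in simp)
  also have "\<dots> \<le> (\<Prod>i<k. e i) * (\<Prod>i<k. g i)"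
    by (rule mult_right_mono[OF top_prod_swap_le[OF S E[unfolded sandwich_gram] Y k]
          sorted_dec_prod_nonneg[OF G k]])
  finally show ?thesis .
qed

text \<open>With \<open>X = A powr t\<close> and \<open>Y = B powr (2 t) * A powr t\<close>, the
  sandwich at \<open>t\<close> is \<open>X * Y\<close> and \<open>?M\<close> is
  \<open>Y * X\<close>, which share their eigenvalues; the Gram matrix of \<open>?M\<close> is the
  sandwich at \<open>2 t\<close>.\<close>

lemma sandwich_top_prod_double:
  assumes F: "sorted_dec m (sandwich m A B t) U f" and G: "sorted_dec m (sandwich m A B (2 * t)) Q g"
    and k: "k \<le> m"
  shows "(\<Prod>i<k. f i)\<^sup>2 \<le> (\<Prod>i<k. g i)"
proof -
  let ?M = "mpow m B (2 * t) * mpow m A (2 * t)" and ?C = "mpow m B (2 * t) * mpow m A t"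
  have M: "?M \<in> carrier_mat m m" "?C \<in> carrier_mat m m" by (auto intro!: mult_carrier_mat[of _ m m])
  have MC: "?M * ?C = ?C * sandwich m A B t"
    by (simp add: sandwich_def mat_assoc mpow_mult_left)
  have KC: "mpow m A t * ?C = sandwich m A B t"
    by (simp add: sandwich_def mat_assoc)
  show ?thesis
    by (rule top_prod_intertwine_le[OF F G[unfolded sandwich_gram] M _ MC KC k]) simp
qed

text \<open>A crude bound that later makes a supremum finite. Replacing each eigenvalue by its
  maximum with 1 makes the powers increase with the exponent.\<close>

lemma sandwich_top_prod_bounded:
  assumes k: "k \<le> m"
  obtains c where "\<And>t U f. 0 < t \<Longrightarrow> t \<le> q \<Longrightarrow> sorted_dec m (sandwich m A B t) U f \<Longrightarrow> (\<Prod>i<k. f i) \<le> c"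
proof -
  obtain U d where U: "sorted_dec m A U d" using psd_sorted_dec[OF A] .
  obtain V e where V: "sorted_dec m B V e" using psd_sorted_dec[OF B] .
  let ?c = "(\<Prod>i<k. max 1 (e i) powr (2 * q)) * (\<Prod>i<k. max 1 (d i) powr (2 * q))"
  have le: "(\<Prod>i<k. d i powr (2 * t)) \<le> (\<Prod>i<k. max 1 (d i) powr (2 * q))"
    if "0 < t" "t \<le> q" "\<And>i. i < m \<Longrightarrow> 0 \<le> d i" for d :: "nat \<Rightarrow> real" and t
  proof (rule prod_mono)
    fix i assume "i \<in> {..<k}"
    then have "0 \<le> d i" using that k by auto
    then have "d i powr (2 * t) \<le> max 1 (d i) powr (2 * t)"
      using that by (intro powr_mono2) auto
    also have "\<dots> \<le> max 1 (d i) powr (2 * q)" using that by (intro powr_mono) auto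
    finally show "0 \<le> d i powr (2 * t) \<and> d i powr (2 * t) \<le> max 1 (d i) powr (2 * q)" by simp
  qed
  have "(\<Prod>i<k. f i) \<le> ?c"
    if "0 < t" "t \<le> q" "sorted_dec m (sandwich m A B t) W f" for t W f
  proof -
    have Bt: "sorted_dec m (ctrans (mpow m B t) * mpow m B t) V (\<lambda>i. e i powr (2 * t))"
      using sorted_dec_mpow[OF V, of "2 * t"] that by (simp add: mpow_mult[OF B])
    have At: "sorted_dec m (ctrans (mpow m A t) * mpow m A t) U (\<lambda>i. d i powr (2 * t))"
      using sorted_dec_mpow[OF U, of "2 * t"] that by (simp add: mpow_mult[OF A])
    have "(\<Prod>i<k. f i) \<le> (\<Prod>i<k. e i powr (2 * t)) * (\<Prod>i<k. d i powr (2 * t))"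
      by (rule top_prod_mult_le[OF that(3)[unfolded sandwich_gram] Bt At _ _ k]) simp_all
    also have "\<dots> \<le> ?c"
      using le[OF that(1,2) sorted_decD(3)[OF V]] le[OF that(1,2) sorted_decD(3)[OF U]]
      by (intro mult_mono) (auto intro!: prod_nonneg)
    finally show ?thesis .
  qed
  then show ?thesis using that by blast
qed

end

subsection \<open>Log-majorization and midpoint log-convexity\<close>

text \<open>The induction carries a stronger bound: the last weight times the plain partial sum
  stays below the weighted sum.\<close>

lemma weighted_prod_le_sum:
  fixes w x :: "nat \<Rightarrow> real"
  assumes "antimono_on {..<n} w" "\<And>i. i < n \<Longrightarrow> 0 \<le> w i"
    and "\<And>k. k \<le> n \<Longrightarrow> 0 \<le> (\<Sum>i<k. x i)"
  shows "0 \<le> (\<Sum>i<n. w i * x i)"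
proof (cases n)
  case (Suc n')
  have "w k * (\<Sum>i<Suc k. x i) \<le> (\<Sum>i<Suc k. w i * x i)" if "k < n" for k
    using that
  proof (induction k)
    case (Suc k)
    have "w (Suc k) \<le> w k" using assms(1) Suc.prems by (auto simp: monotone_on_def)
    then have "w (Suc k) * (\<Sum>i<Suc k. x i) \<le> w k * (\<Sum>i<Suc k. x i)"
      using assms(3)[of "Suc k"] Suc.prems by (intro mult_right_mono) auto
    then show ?case using Suc.IH Suc.prems by (simp add: algebra_simps)
  qed simp
  from this[of n'] show ?thesis
    using assms(2)[of n'] assms(3)[of n] Suc by (metis lessI mult_nonneg_nonneg order_refl order_trans)
qed simp

text \<open>Termwise \<open>b - a \<ge> a * (ln b - ln a)\<close>, strictly unless \<open>a = b\<close>; then Abel summation.\<close>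

lemma log_majorize_imp_sum_le:
  fixes a b :: "nat \<Rightarrow> real"
  assumes mono: "antimono_on {..<n} a"
    and nonneg: "\<And>i. i < n \<Longrightarrow> 0 \<le> a i" "\<And>i. i < n \<Longrightarrow> 0 \<le> b i"
    and le: "\<And>k. k \<le> n \<Longrightarrow> (\<Prod>i<k. a i) \<le> (\<Prod>i<k. b i)"
  shows "(\<Sum>i<n. a i) \<le> (\<Sum>i<n. b i)"
    and "(\<exists>i<n. a i \<noteq> b i) \<Longrightarrow> (\<Sum>i<n. a i) < (\<Sum>i<n. b i)"
proof -
  \<comment> \<open>\<open>r\<close> is the first zero of \<open>a\<close>, or \<open>n\<close>.
    Below it \<open>a\<close> and, through the products, \<open>b\<close> are positive, so
    logarithms are meaningful; from \<open>r\<close> on \<open>a\<close> vanishes by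
    monotonicity.\<close>
  define r where "r = (LEAST i. i = n \<or> a i = 0)"
  have r: "r = n \<or> a r = 0" unfolding r_def by (rule LeastI[of _ n]) simp
  have rn: "r \<le> n" unfolding r_def by (rule Least_le) simp
  have apos: "0 < a i" if "i < r" for i
  proof -
    have "i \<noteq> n" "a i \<noteq> 0" using not_less_Least[OF that[unfolded r_def]] by auto
    then show ?thesis using nonneg(1)[of i] that rn by auto
  qed
  have a0: "a i = 0" if "r \<le> i" "i < n" for i
    using r mono nonneg(1)[of i] that by (fastforce simp: monotone_on_def)
  have bpos: "0 < b i" if i: "i < r" for i
  proof -
    have "0 < (\<Prod>i<Suc i. a i)" using apos i by (intro prod_pos) auto
    also have "\<dots> \<le> (\<Prod>i<Suc i. b i)" using le[of "Suc i"] i rn by simp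
    finally have "b i \<noteq> 0" by (simp add: lessThan_Suc) (metis less_irrefl mult_zero_left)
    then show ?thesis using nonneg(2)[of i] i rn by auto
  qed
  define g where "g i = (if i < r then a i * (ln (b i) - ln (a i)) else 0)" for i
  have g: "g i \<le> b i - a i" "a i \<noteq> b i \<Longrightarrow> g i < b i - a i" if "i < n" for i
  proof -
    have *: "g i = a i * ln (b i / a i) \<and> b i - a i = a i * (b i / a i - 1)" if "i < r"
      using apos[OF that] bpos[OF that] that by (simp add: g_def ln_div field_simps)
    show "g i \<le> b i - a i"
    proof (cases "i < r")
      case True
      then show ?thesis
        using * apos bpos ln_le_minus_one[of "b i / a i"] by (simp only: *) (auto intro: mult_left_mono)
    qed (use that a0 nonneg in \<open>auto simp: g_def\<close>)
    assume ne: "a i \<noteq> b i"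
    show "g i < b i - a i"
    proof (cases "i < r")
      case True
      have "ln (b i / a i) \<noteq> b i / a i - 1"
        using ln_eq_minus_one[of "b i / a i"] apos[OF True] bpos[OF True] ne by auto
      then have "ln (b i / a i) < b i / a i - 1"
        using ln_le_minus_one[of "b i / a i"] apos[OF True] bpos[OF True] by auto
      then show ?thesis
        using * apos True by (simp only: *) (auto intro: mult_strict_left_mono)
    next
      case False
      then have "a i = 0" "g i = 0" using that a0 by (auto simp: g_def)
      then show ?thesis using ne nonneg(2)[OF that] by auto
    qed
  qed
  have "0 \<le> (\<Sum>i<r. a i * (ln (b i) - ln (a i)))"
  proof (rule weighted_prod_le_sum)
    show "antimono_on {..<r} a" using mono rn by (auto simp: monotone_on_def)
    show "0 \<le> (\<Sum>i<k. ln (b i) - ln (a i))" if k: "k \<le> r" for k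
    proof -
      have "ln (\<Prod>i<k. a i) \<le> ln (\<Prod>i<k. b i)"
        using le[of k] k rn apos by (intro ln_mono prod_pos) auto
      moreover have "ln (\<Prod>i<k. a i) = (\<Sum>i<k. ln (a i))"
        using apos[THEN less_imp_neq] k by (intro ln_prod) force+
      moreover have "ln (\<Prod>i<k. b i) = (\<Sum>i<k. ln (b i))"
        using bpos[THEN less_imp_neq] k by (intro ln_prod) force+
      ultimately show ?thesis by (simp add: sum_subtractf)
    qed
  qed (use apos in \<open>auto intro: less_imp_le\<close>)
  also have "\<dots> = (\<Sum>i<n. g i)"
    using rn by (intro sum.mono_neutral_cong_left) (auto simp: g_def)
  finally have 0: "0 \<le> (\<Sum>i<n. g i)" .
  also have "\<dots> \<le> (\<Sum>i<n. b i - a i)" using g by (intro sum_mono) auto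
  finally show "(\<Sum>i<n. a i) \<le> (\<Sum>i<n. b i)" by (simp add: sum_subtractf)
  assume "\<exists>i<n. a i \<noteq> b i"
  then have "(\<Sum>i<n. g i) < (\<Sum>i<n. b i - a i)" using g by (intro sum_strict_mono_ex1) auto
  then show "(\<Sum>i<n. a i) < (\<Sum>i<n. b i)" using 0 by (simp add: sum_subtractf)
qed

text \<open>At the first disagreement \<open>j\<close> one has \<open>a j < b j\<close>, and all
  later partial sums are strictly separated, so \<open>a j\<close> can be raised a little. The order
  survives because the raised entry stays below \<open>b j\<close>, hence below the earlier entries,
  on which \<open>a\<close> and \<open>b\<close> agree.\<close>

lemma raise_below_strict_majorant:
  fixes a b :: "nat \<Rightarrow> real"
  assumes mono: "antimono_on {..<m} a" "antimono_on {..<m} b"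
    and nonneg: "\<And>i. i < m \<Longrightarrow> 0 \<le> a i" "\<And>i. i < m \<Longrightarrow> 0 \<le> b i"
    and le: "\<And>k. k \<le> m \<Longrightarrow> (\<Prod>i<k. a i) \<le> (\<Prod>i<k. b i)"
    and ne: "\<exists>i<m. a i \<noteq> b i"
  obtains a' where "antimono_on {..<m} a'" "\<And>i. i < m \<Longrightarrow> a i \<le> a' i" "\<exists>i<m. a i \<noteq> a' i"
    "\<And>k. k \<le> m \<Longrightarrow> (\<Sum>i<k. a' i) \<le> (\<Sum>i<k. b i)"
proof -
  define j where "j = (LEAST i. i < m \<and> a i \<noteq> b i)"
  have j: "j < m" "a j \<noteq> b j" unfolding j_def using LeastI_ex[OF ne] by auto
  have jl: "a i = b i" if "i < j" for i
    using not_less_Least[OF that[unfolded j_def]] that j by auto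
  have sums: "(\<Sum>i<k. a i) \<le> (\<Sum>i<k. b i)" "j < k \<Longrightarrow> (\<Sum>i<k. a i) < (\<Sum>i<k. b i)" if "k \<le> m" for k
    using log_majorize_imp_sum_le[of k a b] mono(1) nonneg le j that by (auto simp: monotone_on_def)
  have "(\<Sum>i<Suc j. a i) < (\<Sum>i<Suc j. b i)" using sums(2)[of "Suc j"] j by auto
  then have jlt: "a j < b j" using jl by simp
  define \<epsilon> where "\<epsilon> = Min (insert (b j - a j) ((\<lambda>k. (\<Sum>i<k. b i) - (\<Sum>i<k. a i)) ` {j<..m}))"
  have \<epsilon>: "0 < \<epsilon>" "\<epsilon> \<le> b j - a j" "\<And>k. j < k \<Longrightarrow> k \<le> m \<Longrightarrow> \<epsilon> \<le> (\<Sum>i<k. b i) - (\<Sum>i<k. a i)"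
  proof -
    show "0 < \<epsilon>" unfolding \<epsilon>_def using jlt sums by (subst Min_gr_iff) auto
    show "\<epsilon> \<le> b j - a j" unfolding \<epsilon>_def by (rule Min_le) auto
    show "\<epsilon> \<le> (\<Sum>i<k. b i) - (\<Sum>i<k. a i)" if "j < k" "k \<le> m" for k
      unfolding \<epsilon>_def by (rule Min_le) (use that in auto)
  qed
  define a' where "a' = a(j := a j + \<epsilon>)"
  have "antimono_on {..<m} a'"
    unfolding monotone_on_def
  proof (intro ballI impI)
    fix x y assume xy: "x \<in> {..<m}" "y \<in> {..<m}" "x \<le> y"
    have axy: "a y \<le> a x" and bxy: "b y \<le> b x" using xy mono by (auto simp: monotone_on_def)
    consider "y = j" "x < j" | "y = j" "x = j" | "y \<noteq> j" using xy by fastforce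
    then show "a' y \<le> a' x"
    proof cases
      case 1
      then show ?thesis using bxy jl[of x] \<epsilon>(2) by (simp add: a'_def)
    qed (use axy \<epsilon>(1) in \<open>auto simp: a'_def\<close>)
  qed
  moreover have "a i \<le> a' i" for i using \<epsilon>(1) by (simp add: a'_def)
  moreover have "\<exists>i<m. a i \<noteq> a' i" using j \<epsilon>(1) by (auto simp: a'_def intro!: exI[of _ j])
  moreover have "(\<Sum>i<k. a' i) \<le> (\<Sum>i<k. b i)" if k: "k \<le> m" for k
  proof (cases "j < k")
    case True
    have "(\<Sum>i<k. a' i) = (\<Sum>i<k. a i + (if i = j then \<epsilon> else 0))"
      by (intro sum.cong) (auto simp: a'_def)
    also have "\<dots> = (\<Sum>i<k. a i) + \<epsilon>" using True by (simp add: sum.distrib)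
    also have "\<dots> \<le> (\<Sum>i<k. b i)" using \<epsilon>(3)[OF True k] by simp
    finally show ?thesis .
  next
    case False
    then have "(\<Sum>i<k. a' i) = (\<Sum>i<k. a i)" by (intro sum.cong) (auto simp: a'_def)
    then show ?thesis using sums(1)[OF k] by simp
  qed
  ultimately show ?thesis using that by blast
qed

text \<open>The supremum \<open>S\<close> of \<open>F t / c powr (t / q)\<close> over \<open>{0<..q}\<close> satisfies \<open>S\<^sup>2 \<le> S\<close>.\<close>

lemma midpoint_log_convex_le_powr:
  fixes F :: "real \<Rightarrow> real"
  assumes q: "0 < q" and c: "0 < c" "F q \<le> c"
    and nonneg: "\<And>t. 0 < t \<Longrightarrow> 0 \<le> F t"
    and double: "\<And>t. 0 < t \<Longrightarrow> (F t)\<^sup>2 \<le> F (2 * t)"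
    and mid: "\<And>s t. 0 < s \<Longrightarrow> 0 < t \<Longrightarrow> (F ((s + t) / 2))\<^sup>2 \<le> F s * F t"
    and bounded: "\<And>t. 0 < t \<Longrightarrow> t \<le> q \<Longrightarrow> F t \<le> B"
    and p: "0 < p" "p \<le> q"
  shows "F p \<le> c powr (p / q)"
proof -
  define G where "G t = F t / c powr (t / q)" for t
  have cp: "0 < c powr x" for x using c by simp
  have G2: "(G t)\<^sup>2 = (F t)\<^sup>2 / c powr (2 * t / q)" for t
  proof -
    have "c powr (2 * t / q) = c powr (t / q + t / q)" by simp
    also have "\<dots> = (c powr (t / q))\<^sup>2" by (simp only: powr_add power2_eq_square)
    finally show ?thesis by (simp add: G_def power_divide)
  qed
  have G0: "0 \<le> G t" if "0 < t" for t using nonneg[OF that] by (simp add: G_def)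
  \<comment> \<open>A bound for the numerator divided by a lower bound for \<open>c powr x\<close>
    with \<open>x\<close> between 0 and 1.\<close>
  define B' where "B' = max 0 B * (1 / min 1 c)"
  have cmin: "min 1 c \<le> c powr (t / q)" if "0 < t" "t \<le> q" for t
  proof (cases "1 \<le> c")
    case True
    then show ?thesis using q that ge_one_powr_ge_zero[of c "t / q"] by auto
  next
    case False
    have "c powr 1 \<le> c powr (t / q)"
      using False c q that by (intro powr_mono') auto
    then show ?thesis using c by auto
  qed
  have GB: "G t \<le> B'" if t: "0 < t" "t \<le> q" for t
    using bounded[OF t] cmin[OF t] c nonneg[OF t(1)]
    unfolding G_def B'_def by (auto intro!: frac_le simp: max_def)
  define S where "S = (SUP t\<in>{0<..q}. G t)"
  have bdd: "bdd_above (G ` {0<..q})" using GB by (intro bdd_aboveI2) auto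
  have GS: "G t \<le> S" if "0 < t" "t \<le> q" for t
    unfolding S_def using that by (intro cSUP_upper bdd) auto
  have S0: "0 \<le> S" using GS[of q] G0[of q] q by linarith
  have Gq: "G q \<le> 1" using q c by (simp add: G_def)
  \<comment> \<open>Up to \<open>q / 2\<close> doubling stays inside the range; beyond it
    \<open>t\<close> is the midpoint of \<open>2 * t - q\<close> and \<open>q\<close>, and
    \<open>G q \<le> 1\<close>.\<close>
  have sq: "(G t)\<^sup>2 \<le> S" if t: "0 < t" "t \<le> q" for t
  proof (cases "t \<le> q / 2")
    case True
    have "(G t)\<^sup>2 = (F t)\<^sup>2 / c powr (2 * t / q)" by (rule G2)
    also have "\<dots> \<le> G (2 * t)" unfolding G_def using double[OF t(1)] by (intro divide_right_mono) auto
    also have "\<dots> \<le> S" using True t by (intro GS) auto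
    finally show ?thesis .
  next
    case False
    then have s: "0 < 2 * t - q" "2 * t - q \<le> q" using t by auto
    have "(G t)\<^sup>2 = (F t)\<^sup>2 / c powr (2 * t / q)" by (rule G2)
    also have "\<dots> \<le> F (2 * t - q) * F q / c powr (2 * t / q)"
      using mid[OF s(1) q] by (intro divide_right_mono) auto
    also have "\<dots> = G (2 * t - q) * G q"
      using q c by (simp add: G_def diff_divide_distrib powr_diff)
    also have "\<dots> \<le> S * 1"
      using GS[OF s] S0 G0[OF q] Gq by (intro mult_mono) auto
    finally show ?thesis by simp
  qed
  have "(SUP t\<in>{0<..q}. G t) \<le> sqrt S"
    by (rule cSUP_least) (use q sq in \<open>auto intro!: real_le_rsqrt\<close>)
  then have "S \<le> sqrt S" by (simp only: S_def)
  then have "S\<^sup>2 \<le> (sqrt S)\<^sup>2" using S0 by (rule power_mono)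
  then have "S * S \<le> S" using S0 by (simp add: power2_eq_square)
  have "S \<le> 1"
  proof (rule ccontr)
    assume "\<not> S \<le> 1"
    then have "S * 1 < S * S" by (intro mult_strict_left_mono) auto
    then show False using \<open>S * S \<le> S\<close> by simp
  qed
  then have "G p \<le> 1" using GS[of p] p by simp
  then show ?thesis using cp[of "p / q"] by (simp add: G_def)
qed

text \<open>In the equality case with \<open>F q > 0\<close>, the normalised function
  \<open>G\<close> is at most 1 and reaches 1 at \<open>p\<close>. Doubling moves the value 1 into
  the range from \<open>q / 2\<close> to \<open>q\<close>; midpoint convexity then spreads it to
  both ends of intervals centred there, until \<open>q / 2\<close> is reached.\<close>

lemma midpoint_log_convex_equality:
  fixes F :: "real \<Rightarrow> real"
  assumes p: "0 < p" "p < q"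
    and nonneg: "\<And>t. 0 < t \<Longrightarrow> 0 \<le> F t"
    and double: "\<And>t. 0 < t \<Longrightarrow> (F t)\<^sup>2 \<le> F (2 * t)"
    and mid: "\<And>s t. 0 < s \<Longrightarrow> 0 < t \<Longrightarrow> (F ((s + t) / 2))\<^sup>2 \<le> F s * F t"
    and bounded: "\<And>t. 0 < t \<Longrightarrow> t \<le> q \<Longrightarrow> F t \<le> B"
  shows "F p \<le> F q powr (p / q)"
    and "F p = F q powr (p / q) \<Longrightarrow> (F (q / 2))\<^sup>2 = F q"
proof -
  have q: "0 < q" using p by simp
  have le: "F t \<le> c powr (t / q)" if "0 < c" "F q \<le> c" "0 < t" "t \<le> q" for c t
    by (rule midpoint_log_convex_le_powr[OF q that(1,2) nonneg double mid bounded that(3,4)])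
  show "F p \<le> F q powr (p / q)"
  proof (cases "F q = 0")
    case True
    show ?thesis
    proof (rule ccontr)
      assume "\<not> ?thesis"
      then have Fp: "0 < F p" using True by simp
      \<comment> \<open>As \<open>F q = 0\<close>, every positive \<open>c\<close> is admissible;
        this one turns the bound into \<open>F p \<le> F p / 2\<close>.\<close>
      have "F p \<le> ((F p / 2) powr (q / p)) powr (p / q)"
        by (rule le) (use Fp True p in auto)
      then show False using Fp p by (simp add: powr_powr)
    qed
  next
    case False
    then have "0 < F q" using nonneg[OF q] by simp
    from le[OF this order_refl p(1)] show ?thesis using p by simp
  qed
  assume eq: "F p = F q powr (p / q)"
  show "(F (q / 2))\<^sup>2 = F q"
  proof (cases "F q = 0")
    case True
    then show ?thesis using double[of "q / 2"] q by simp
  next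
    case False
    then have Fq: "0 < F q" using nonneg[OF q] by simp
    define G where "G t = F t / F q powr (t / q)" for t
    have G1: "G t \<le> 1" if "0 < t" "t \<le> q" for t
      using le[OF Fq order_refl that] Fq by (simp add: G_def)
    have G0: "0 \<le> G t" if "0 < t" for t using nonneg[OF that] by (simp add: G_def)
    have sq: "(F q powr x)\<^sup>2 = F q powr (2 * x)" for x
      by (simp add: power2_eq_square flip: powr_add)
    have Gmid: "(G ((s + t) / 2))\<^sup>2 \<le> G s * G t" if "0 < s" "0 < t" for s t
    proof -
      have "(F q powr ((s + t) / 2 / q))\<^sup>2 = F q powr (s / q) * F q powr (t / q)"
        unfolding sq by (simp add: add_divide_distrib flip: powr_add)
      then show ?thesis
        unfolding G_def power_divide using mid[OF that] Fq by (simp add: divide_right_mono)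
    qed
    have Gdouble: "(G t)\<^sup>2 \<le> G (2 * t)" if "0 < t" for t
      unfolding G_def power_divide sq using double[OF that] Fq by (simp add: divide_right_mono)
    have one: "G s = 1" if "0 < s" "s \<le> q" "0 < t" "t \<le> q" "G ((s + t) / 2) = 1" for s t
    proof -
      have "1 \<le> G s * G t" using Gmid[of s t] that by simp
      also have "\<dots> \<le> G s * 1" using G1[of t] G0[of s] that by (intro mult_left_mono) auto
      finally show ?thesis using G1[of s] that by simp
    qed
    \<comment> \<open>Passing from \<open>t\<close> to \<open>2 * t - q\<close> doubles the distance
      to \<open>q\<close>, so \<open>n\<close> steps suffice. Once the next point would not exceed
      \<open>q / 2\<close>, the interval from \<open>q / 2\<close> to \<open>2 * t - q / 2\<close>,
      centred at \<open>t\<close>, fits below \<open>q\<close>.\<close>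
    have upper: "G (q / 2) = 1" if "q / 2 \<le> 2 ^ n * (q - t)" "q / 2 \<le> t" "t < q" "G t = 1" for n t
      using that
    proof (induction n arbitrary: t)
      case 0
      then have "q / 2 = t" by simp
      then show ?case using 0 by (simp only:)
    next
      case (Suc n)
      show ?case
      proof (cases "2 * t - q \<le> q / 2")
        case True
        show ?thesis by (rule one[of _ "2 * t - q / 2"]) (use True Suc.prems q in auto)
      next
        case False
        have "G (2 * t - q) = 1" by (rule one[of _ q]) (use False Suc.prems q in auto)
        then show ?thesis
          using Suc.IH[of "2 * t - q"] False Suc.prems by (simp add: algebra_simps)
      qed
    qed
    have lower: "\<exists>t'. q / 2 \<le> t' \<and> t' < q \<and> G t' = 1" if "q / 2 \<le> 2 ^ n * t" "0 < t" "t < q" "G t = 1" for n t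
      using that
    proof (induction n arbitrary: t)
      case 0
      then show ?case by (intro exI[of _ t]) auto
    next
      case (Suc n)
      show ?case
      proof (cases "q / 2 \<le> t")
        case True
        then show ?thesis using Suc.prems by (intro exI[of _ t]) auto
      next
        case False
        have "1 \<le> G (2 * t)" using Gdouble[of t] Suc.prems by simp
        then have "G (2 * t) = 1" using G1[of "2 * t"] False Suc.prems by simp
        then show ?thesis using Suc.IH[of "2 * t"] False Suc.prems by (simp add: algebra_simps)
      qed
    qed
    have large: "\<exists>n. x \<le> 2 ^ n * y" if "0 < y" for x y :: real
    proof -
      obtain n where "x / y < 2 ^ n" using real_arch_pow[of 2 "x / y"] by auto
      then show ?thesis using that by (auto simp: field_simps intro!: exI[of _ n])
    qed
    have "G p = 1" using eq Fq by (simp add: G_def)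
    then obtain t where t: "q / 2 \<le> t" "t < q" "G t = 1"
      using large[OF p(1), of "q / 2"] lower[of _ p] p by blast
    then have "G (q / 2) = 1" using large[of "q - t" "q / 2"] upper[of _ t] by auto
    then have "F (q / 2) = F q powr (1 / 2)" using Fq q by (simp add: G_def)
    then show ?thesis using sq[of "1 / 2"] Fq by simp
  qed
qed

subsection \<open>Unitarily invariant norms of diagonal matrices\<close>

lemma dmat_update_reflect:
  "dmat m (d(i := - d i)) = dmat m (\<lambda>j. if j = i then -1 else 1) * dmat m d * 1\<^sub>m m"
proof -
  have "(\<lambda>j. complex_of_real (if j = i then -1 else 1) * complex_of_real (d j))
      = (\<lambda>j. complex_of_real ((d(i := - d i)) j))"
    by auto
  then show ?thesis by (simp only: mat_diag_diag right_mult_one_mat[OF mat_diag_dim])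
qed

lemma unitary_reflection: "unitary_mat m (dmat m (\<lambda>j. if j = i then -1 else 1))"
proof (rule unitary_matI)
  have "(\<lambda>j. complex_of_real (if j = i then -1 else 1) * complex_of_real (if j = i then -1 else 1)) = (\<lambda>_. 1)"
    by auto
  then show "ctrans (dmat m (\<lambda>j. if j = i then -1 else 1)) * dmat m (\<lambda>j. if j = i then -1 else 1) = 1\<^sub>m m"
    by (simp only: ctrans_mat_diag_real mat_diag_diag mat_diag_one)
qed simp

lemma loewner_le_dmat:
  assumes "\<And>i. i < m \<Longrightarrow> a i \<le> b i"
  shows "loewner_le m (dmat m a) (dmat m b)"
proof -
  have "dmat m b - dmat m a = dmat m (\<lambda>i. b i - a i)"
    by (rule eq_matI) (auto simp: mat_diag_def)
  then show ?thesis using psd_mat_diag[of m "\<lambda>i. b i - a i"] assms by (simp add: loewner_le_def)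
qed

context
  fixes m :: nat and N :: "complex mat \<Rightarrow> real"
  assumes N: "unitarily_invariant_norm m N"
begin

lemma norm_unitary_conj:
  assumes "unitary_mat m U" "X \<in> carrier_mat m m"
  shows "N (U * X * ctrans U) = N X"
  using N assms unitary_ctrans by (auto simp: unitarily_invariant_norm_def)

lemma norm_dmat_comb:
  assumes "0 \<le> \<alpha>" "0 \<le> \<beta>" "\<And>i. i < m \<Longrightarrow> h i = \<alpha> * f i + \<beta> * g i"
  shows "N (dmat m h) \<le> \<alpha> * N (dmat m f) + \<beta> * N (dmat m g)"
proof -
  have n: "N (c \<cdot>\<^sub>m X) = cmod c * N X" "N (X + Y) \<le> N X + N Y"
    if "X \<in> carrier_mat m m" "Y \<in> carrier_mat m m" for c X Y
    using N that by (auto simp: unitarily_invariant_norm_def matrix_norm_def)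
  have "dmat m h = complex_of_real \<alpha> \<cdot>\<^sub>m dmat m f + complex_of_real \<beta> \<cdot>\<^sub>m dmat m g"
    by (rule eq_matI) (use assms(3) in \<open>auto simp: mat_diag_def\<close>)
  also have "N \<dots> \<le> N (complex_of_real \<alpha> \<cdot>\<^sub>m dmat m f) + N (complex_of_real \<beta> \<cdot>\<^sub>m dmat m g)"
    by (rule n(2)) auto
  also have "\<dots> = \<alpha> * N (dmat m f) + \<beta> * N (dmat m g)"
    using n(1)[of "dmat m f" "dmat m f"] n(1)[of "dmat m g" "dmat m g"] assms(1,2) by simp
  finally show ?thesis .
qed

text \<open>The lowered list is a convex combination of \<open>b\<close> and of \<open>b\<close>
  with the sign of that coordinate flipped, which has the same norm.\<close>

lemma norm_dmat_update_le:
  assumes "0 \<le> x" "x \<le> b i"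
  shows "N (dmat m (b(i := x))) \<le> N (dmat m b)"
proof (cases "b i = 0")
  case False
  define s where "s = x / b i"
  have s: "0 \<le> s" "s \<le> 1" "x = s * b i" using assms False by (auto simp: s_def)
  have "N (dmat m (b(i := - b i))) = N (dmat m b)"
    using N unitary_reflection unitary_one mat_diag_dim
    unfolding dmat_update_reflect unitarily_invariant_norm_def by blast
  moreover have "N (dmat m (b(i := x))) \<le> (1 + s) / 2 * N (dmat m b) + (1 - s) / 2 * N (dmat m (b(i := - b i)))"
    by (rule norm_dmat_comb) (use s in \<open>auto simp: field_simps\<close>)
  ultimately show ?thesis by (simp add: field_simps)
next
  case True
  then have "x = b i" using assms by simp
  then show ?thesis by simp
qed

text \<open>A T-transform is a convex combination of \<open>b\<close> and of \<open>b\<close> with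
  two entries exchanged; the exchanged list also diagonalises \<open>dmat m b\<close>, so it has the
  same norm.\<close>

lemma norm_dmat_transfer_le:
  assumes ik: "i < m" "k < m" "i \<noteq> k" and b: "\<And>j. j < m \<Longrightarrow> 0 \<le> b j"
    and \<delta>: "0 \<le> \<delta>" "\<delta> \<le> b i - b k" "b k < b i"
  shows "N (dmat m (b(i := b i - \<delta>, k := b k + \<delta>))) \<le> N (dmat m b)"
proof -
  define \<sigma> where "\<sigma> = Fun.swap i k id"
  have "bij_betw \<sigma> {..<m} {..<m}"
    using ik by (auto simp: \<sigma>_def bij_betw_swap_iff)
  moreover have "spectral_dec m (dmat m b) (1\<^sub>m m) b"
    using b unitary_one by (simp add: spectral_dec_def)
  ultimately obtain V where "spectral_dec m (dmat m b) V (b \<circ> \<sigma>)"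
    using spectral_dec_permute by blast
  then have eq: "N (dmat m (b \<circ> \<sigma>)) = N (dmat m b)"
    using norm_unitary_conj[of V "dmat m (b \<circ> \<sigma>)"] by (simp add: spectral_dec_def)
  define \<tau> where "\<tau> = \<delta> / (b i - b k)"
  have \<tau>: "0 \<le> \<tau>" "\<tau> \<le> 1" "\<delta> = \<tau> * (b i - b k)" using \<delta> by (auto simp: \<tau>_def)
  have "N (dmat m (b(i := b i - \<delta>, k := b k + \<delta>))) \<le> (1 - \<tau>) * N (dmat m b) + \<tau> * N (dmat m (b \<circ> \<sigma>))"
    by (rule norm_dmat_comb)
      (use \<tau> ik in \<open>auto simp: \<sigma>_def transpose_def algebra_simps\<close>)
  also have "\<dots> = N (dmat m b)" unfolding eq by (simp add: algebra_simps)
  finally show ?thesis .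
qed

text \<open>As long as \<open>a \<noteq> b\<close>, a T-transform or the lowering of a coordinate makes \<open>b\<close> agree with \<open>a\<close> at
  one more index and keeps the partial sums of \<open>b\<close> above those of \<open>a\<close>.\<close>

lemma norm_dmat_weak_majorize_le:
  assumes mono: "antimono_on {..<m} a" and a: "\<And>i. i < m \<Longrightarrow> 0 \<le> a i"
    and "\<And>i. i < m \<Longrightarrow> 0 \<le> b i" and "\<And>k. k \<le> m \<Longrightarrow> (\<Sum>i<k. a i) \<le> (\<Sum>i<k. b i)"
  shows "N (dmat m a) \<le> N (dmat m b)"
  using assms(3,4)
proof (induction "card {i. i < m \<and> a i \<noteq> b i}" arbitrary: b rule: less_induct)
  case less
  note b = less.prems(1) and sums = less.prems(2)
  have step: ?case
    if "{i. i < m \<and> a i \<noteq> b' i} \<subset> {i. i < m \<and> a i \<noteq> b i}" "\<And>i. i < m \<Longrightarrow> 0 \<le> b' i"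
      "\<And>k. k \<le> m \<Longrightarrow> (\<Sum>i<k. a i) \<le> (\<Sum>i<k. b' i)" "N (dmat m b') \<le> N (dmat m b)" for b'
    using less.hyps[OF psubset_card_mono[OF _ that(1)] that(2,3)] that(4) by simp
  consider (above) "\<exists>k<m. b k < a k" | (below) i where "i < m" "a i < b i" "\<forall>k<m. a k \<le> b k"
    | (equal) "\<forall>k<m. a k = b k"
    by (metis linorder_not_less order_le_less)
  then show ?case
  proof cases
    case above
    \<comment> \<open>At the first deficit \<open>k\<close>, the partial sums force an excess at
      some earlier \<open>i\<close>. The amount moved settles at least one of the two indices and
      leaves everything before \<open>k\<close> above \<open>a\<close>.\<close>
    define k where "k = (LEAST k. k < m \<and> b k < a k)"
    have k: "k < m" "b k < a k" unfolding k_def using LeastI_ex[OF above] by auto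
    have kl: "a x \<le> b x" if "x < k" for x
      using not_less_Least[OF that[unfolded k_def]] that k by auto
    have "\<exists>i<k. a i < b i"
    proof (rule ccontr)
      assume "\<not> ?thesis"
      then have "(\<Sum>i<k. b i) \<le> (\<Sum>i<k. a i)" by (intro sum_mono) (meson lessThan_iff not_less)
      then show False using sums[of "Suc k"] k by simp
    qed
    then obtain i where i: "i < k" "a i < b i" by blast
    define \<delta> where "\<delta> = min (b i - a i) (a k - b k)"
    have \<delta>: "0 < \<delta>" "\<delta> \<le> b i - a i" "\<delta> \<le> a k - b k" "\<delta> = b i - a i \<or> \<delta> = a k - b k"
      using i k by (auto simp: \<delta>_def min_def)
    have aik: "a k \<le> a i" using mono i k by (auto simp: monotone_on_def)
    define b' where "b' = b(i := b i - \<delta>, k := b k + \<delta>)"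
    show ?thesis
    proof (rule step[of b'])
      have "{j. j < m \<and> a j \<noteq> b' j} \<subseteq> {j. j < m \<and> a j \<noteq> b j}"
        using i k by (auto simp: b'_def)
      moreover have "i \<in> {j. j < m \<and> a j \<noteq> b j}" "k \<in> {j. j < m \<and> a j \<noteq> b j}" using i k by auto
      moreover have "i \<notin> {j. j < m \<and> a j \<noteq> b' j} \<or> k \<notin> {j. j < m \<and> a j \<noteq> b' j}"
        using \<delta>(4) i by (auto simp: b'_def)
      ultimately show "{j. j < m \<and> a j \<noteq> b' j} \<subset> {j. j < m \<and> a j \<noteq> b j}" by blast
      show "0 \<le> b' j" if "j < m" for j
        using b[OF that] \<delta> a[of i] i k by (auto simp: b'_def)
      show "(\<Sum>i<l. a i) \<le> (\<Sum>i<l. b' i)" if l: "l \<le> m" for l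
      proof (cases "k < l")
        case True
        have "(\<Sum>j<l. b' j) = (\<Sum>j<l. b j + ((if j = k then \<delta> else 0) - (if j = i then \<delta> else 0)))"
          using i by (intro sum.cong) (auto simp: b'_def)
        also have "\<dots> = (\<Sum>j<l. b j)" using True i by (simp add: sum.distrib sum_subtractf)
        finally show ?thesis using sums[OF l] by simp
      next
        case False
        show ?thesis
          by (intro sum_mono) (use False kl \<delta>(2) i in \<open>auto simp: b'_def\<close>)
      qed
      show "N (dmat m b') \<le> N (dmat m b)"
        unfolding b'_def
        by (rule norm_dmat_transfer_le) (use i k \<delta> aik b in auto)
    qed
  next
    \<comment> \<open>No deficit is left, so lowering one excess to \<open>a i\<close> keeps all
      partial sums large enough.\<close>
    case (below i)
    show ?thesis
    proof (rule step[of "b(i := a i)"])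
      show "{j. j < m \<and> a j \<noteq> (b(i := a i)) j} \<subset> {j. j < m \<and> a j \<noteq> b j}" using below by auto
      show "0 \<le> (b(i := a i)) j" if "j < m" for j using that a b by auto
      show "(\<Sum>j<k. a j) \<le> (\<Sum>j<k. (b(i := a i)) j)" if "k \<le> m" for k
        by (intro sum_mono) (use below that in auto)
      show "N (dmat m (b(i := a i))) \<le> N (dmat m b)"
        by (rule norm_dmat_update_le) (use below a in auto)
    qed
  next
    case equal
    then have "dmat m a = dmat m b" by (auto simp: mat_diag_def intro!: eq_matI)
    then show ?thesis by simp
  qed
qed

text \<open>If the lists differed, \<open>a\<close> could be raised to some \<open>a'\<close> still
  weakly majorized by \<open>b\<close>. The three norms then coincide, and strictness on the
  comparable diagonal matrices of \<open>a\<close> and \<open>a'\<close> gives a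
  contradiction.\<close>

lemma strictly_increasing_norm_log_majorize_eq:
  assumes strict: "strictly_increasing_norm m N"
    and mono: "antimono_on {..<m} a" "antimono_on {..<m} b"
    and nonneg: "\<And>i. i < m \<Longrightarrow> 0 \<le> a i" "\<And>i. i < m \<Longrightarrow> 0 \<le> b i"
    and le: "\<And>k. k \<le> m \<Longrightarrow> (\<Prod>i<k. a i) \<le> (\<Prod>i<k. b i)"
    and eq: "N (dmat m a) = N (dmat m b)"
  shows "\<forall>i<m. a i = b i"
proof (rule ccontr)
  assume "\<not> ?thesis"
  then have "\<exists>i<m. a i \<noteq> b i" by blast
  then obtain a' where a': "antimono_on {..<m} a'" "\<And>i. i < m \<Longrightarrow> a i \<le> a' i" "\<exists>i<m. a i \<noteq> a' i"
    "\<And>k. k \<le> m \<Longrightarrow> (\<Sum>i<k. a' i) \<le> (\<Sum>i<k. b i)"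
    using raise_below_strict_majorant[OF mono nonneg le] by blast
  have a'0: "0 \<le> a' i" if "i < m" for i using a'(2) nonneg(1) that order_trans by blast
  have "N (dmat m a') \<le> N (dmat m b)"
    by (rule norm_dmat_weak_majorize_le[OF a'(1) a'0 nonneg(2) a'(4)])
  moreover have "N (dmat m a) \<le> N (dmat m a')"
    by (rule norm_dmat_weak_majorize_le[OF mono(1) nonneg(1) a'0]) (auto intro!: sum_mono a'(2))
  ultimately have "N (dmat m a) = N (dmat m a')" using eq by simp
  then have E: "dmat m a = dmat m a'"
    using strict psd_mat_diag[of m a] psd_mat_diag[of m a'] nonneg(1) a'0 loewner_le_dmat[of m a a'] a'(2)
    unfolding strictly_increasing_norm_def by blast
  have "a i = a' i" if "i < m" for i
  proof -
    have "complex_of_real (a i) = dmat m a $$ (i,i)" using that by (simp add: mat_diag_def)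
    also have "\<dots> = dmat m a' $$ (i,i)" by (simp only: E)
    also have "\<dots> = complex_of_real (a' i)" using that by (simp add: mat_diag_def)
    finally show ?thesis by (simp only: of_real_eq_iff)
  qed
  then show False using a'(3) by blast
qed

end

subsection \<open>Equality of eigenvalues forces commutation\<close>

lemma trace_mult_commute:
  fixes X Y :: "complex mat"
  assumes "X \<in> carrier_mat m m" "Y \<in> carrier_mat m m"
  shows "(\<Sum>i<m. (X * Y) $$ (i,i)) = (\<Sum>i<m. (Y * X) $$ (i,i))"
proof -
  have "(\<Sum>i<m. (X * Y) $$ (i,i)) = (\<Sum>i<m. \<Sum>j<m. X $$ (i,j) * Y $$ (j,i))"
    using assms by (simp add: mult_index_sum del: index_mult_mat(1))
  also have "\<dots> = (\<Sum>j<m. \<Sum>i<m. X $$ (i,j) * Y $$ (j,i))" by (rule sum.swap)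
  also have "\<dots> = (\<Sum>i<m. (Y * X) $$ (i,i))"
    using assms by (auto simp: mult_index_sum mult.commute simp del: index_mult_mat(1) intro!: sum.cong)
  finally show ?thesis .
qed

lemma trace_spectral:
  assumes "spectral_dec m H U d"
  shows "(\<Sum>i<m. H $$ (i,i)) = (\<Sum>i<m. complex_of_real (d i))"
proof -
  have U: "unitary_mat m U" "H = U * (dmat m d * ctrans U)"
    using assms unitary_matD[of m U] by (auto simp: spectral_dec_def mat_assoc)
  note Uc = unitary_matD[OF U(1)]
  have "(\<Sum>i<m. H $$ (i,i)) = (\<Sum>i<m. (dmat m d * ctrans U * U) $$ (i,i))"
    unfolding U(2)
    by (rule trace_mult_commute[OF Uc(1) mult_carrier_mat[OF mat_diag_dim ctrans_carrier[OF Uc(1)]]])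
  also have "dmat m d * ctrans U * U = dmat m d" using unitary_cancel_right[OF U(1)] by simp
  finally show ?thesis by (simp add: mat_diag_def)
qed

text \<open>By cyclicity of the trace, the squared Frobenius norm of the commutator is twice the
  difference of the traces of \<open>C E E C\<close> and \<open>C E C E\<close>.\<close>

lemma commute_of_trace_eq:
  assumes C: "C \<in> carrier_mat m m" "ctrans C = C" and E: "E \<in> carrier_mat m m" "ctrans E = E"
    and tr: "(\<Sum>i<m. (C * (E * (E * C))) $$ (i,i)) = (\<Sum>i<m. (C * (E * (C * E))) $$ (i,i))"
  shows "C * E = E * C"
proof -
  have CE: "C * E \<in> carrier_mat m m" "E * C \<in> carrier_mat m m" using C E by (auto intro: mult_carrier_mat)
  define K where "K = C * E - E * C"
  have K: "K \<in> carrier_mat m m" unfolding K_def by (rule minus_carrier_mat[OF CE(2)])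
  have cK: "ctrans K = E * C - C * E"
  proof -
    have "ctrans K = ctrans (C * E) - ctrans (E * C)"
      unfolding K_def by (rule eq_matI) (use C(1) E(1) in \<open>auto simp del: index_mult_mat(1)\<close>)
    then show ?thesis using C E by (simp add: ctrans_mult)
  qed
  let ?t = "\<lambda>X. \<Sum>i<m. X $$ (i,i)"
  have c4: "C * (E * (E * C)) \<in> carrier_mat m m" "E * (C * (C * E)) \<in> carrier_mat m m"
    "C * (E * (C * E)) \<in> carrier_mat m m" "E * (C * (E * C)) \<in> carrier_mat m m"
    using C E by (auto intro!: mult_carrier_mat[of _ m m])
  have "ctrans K * K = (E * C) * (C * E) - (E * C) * (E * C) - ((C * E) * (C * E) - (C * E) * (E * C))"
    unfolding cK unfolding K_def
    by (simp only: minus_mult_distrib_mat[OF CE(2,1) minus_carrier_mat[OF CE(2)]]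
        mult_minus_distrib_mat[OF CE(2,1,2)] mult_minus_distrib_mat[OF CE(1,1,2)])
  also have "\<dots> = E * (C * (C * E)) - E * (C * (E * C)) - (C * (E * (C * E)) - C * (E * (E * C)))"
    using C E by (simp add: mat_assoc)
  finally have "?t (ctrans K * K) = ?t (E * (C * (C * E))) - ?t (E * (C * (E * C)))
      - (?t (C * (E * (C * E))) - ?t (C * (E * (E * C))))"
    using C E by (simp add: sum_subtractf del: index_mult_mat(1))
  also have "?t (E * (C * (C * E))) = ?t (C * (E * (E * C)))"
  proof -
    have "?t (E * (C * (C * E))) = ?t ((E * C) * (C * E))" using C E by (simp add: mat_assoc)
    also have "\<dots> = ?t ((C * E) * (E * C))" by (rule trace_mult_commute[OF CE(2,1)])
    finally show ?thesis using C E by (simp add: mat_assoc)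
  qed
  also have "?t (E * (C * (E * C))) = ?t (C * (E * (C * E)))"
  proof -
    have "?t (E * (C * (E * C))) = ?t ((C * (E * C)) * E)"
      by (rule trace_mult_commute) (use C E in \<open>auto intro!: mult_carrier_mat[of _ m m]\<close>)
    then show ?thesis using C E by (simp add: mat_assoc)
  qed
  finally have "?t (ctrans K * K) = 0" by (simp add: tr)
  moreover have "?t (ctrans K * K) = complex_of_real (\<Sum>i<m. \<Sum>l<m. (cmod (K $$ (l,i)))\<^sup>2)"
    using gram_index[OF K] by simp
  ultimately have "complex_of_real (\<Sum>i<m. \<Sum>l<m. (cmod (K $$ (l,i)))\<^sup>2) = 0" by simp
  then have "(\<Sum>i<m. \<Sum>l<m. (cmod (K $$ (l,i)))\<^sup>2) = 0" by (simp only: of_real_eq_0_iff)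
  then have K0: "K $$ (l,i) = 0" if "i < m" "l < m" for i l
    using that by (simp add: sum_nonneg_eq_0_iff sum_nonneg)
  show ?thesis
  proof (rule eq_matI)
    fix i j assume "i < dim_row (E * C)" "j < dim_col (E * C)"
    then have ij: "i < m" "j < m" using C E by auto
    have "K $$ (i,j) = (C * E) $$ (i,j) - (E * C) $$ (i,j)"
      unfolding K_def using ij C E by (simp del: index_mult_mat(1))
    then show "(C * E) $$ (i,j) = (E * C) $$ (i,j)" using K0[OF ij(2,1)] by simp
  qed (use C E in auto)
qed

text \<open>The power \<open>1 / r\<close> undoes \<open>r\<close>; it is applied to one factor at a
  time, since what commutes with a matrix commutes with its powers.\<close>

lemma commute_of_mpow_commute:
  assumes A: "psd m A" and B: "psd m B" and "r \<noteq> 0"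
    and "mpow m A r * mpow m B r = mpow m B r * mpow m A r"
  shows "A * B = B * A"
proof -
  note Ar = psd_mpow[OF A, of r] and Br = psd_mpow[OF B, of r]
  have A': "mpow m (mpow m A r) (1 / r) = A" and B': "mpow m (mpow m B r) (1 / r) = B"
    using assms(3) by (simp_all add: mpow_mpow[OF A] mpow_mpow[OF B] mpow_one[OF A] mpow_one[OF B])
  have "A * mpow m B r = mpow m B r * A"
    using mpow_commute[OF Ar psdD(1)[OF Br] assms(4), of "1 / r"] by (simp add: A')
  then show ?thesis
    using mpow_commute[OF Br psdD(1)[OF A], of "1 / r"] by (simp add: B')
qed

theorem theorem2p1:
  fixes m :: nat and A B :: "complex mat" and N :: "complex mat \<Rightarrow> real" and p q :: real
  assumes "psd m A" and "psd m B"
    and "unitarily_invariant_norm m N" and "strictly_increasing_norm m N"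
    and "0 < p" and "p < q"
    and "N (mpow m (mpow m A (p/2) * mpow m B p * mpow m A (p/2)) (1/p))
       = N (mpow m (mpow m A (q/2) * mpow m B q * mpow m A (q/2)) (1/q))"
  shows "A * B = B * A"
proof -
  note A = assms(1) and B = assms(2) and N = assms(3)
  note q = \<open>0 < p\<close> \<open>p < q\<close>
  let ?H = "sandwich m A B"
  \<comment> \<open>One sorted decomposition is fixed for every \<open>t\<close> at once, so that
    the products \<open>F k\<close> become functions of \<open>t\<close>.\<close>
  have "\<forall>t. \<exists>U d. sorted_dec m (?H t) U d"
    using psd_sorted_dec[OF sandwich_psd[OF A B]] by blast
  then obtain U d where dec: "\<And>t. sorted_dec m (?H t) (U t) (d t)" by metis
  have d0: "0 \<le> d t i" if "i < m" for t i using sorted_decD(3)[OF dec that] .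
  have dmono: "antimono_on {..<m} (d t)" for t using sorted_decD(4)[OF dec] .
  define F where "F k t = (\<Prod>i<k. d t i)" for k t
  have F0: "0 \<le> F k t" if "k \<le> m" for k t
    unfolding F_def by (rule sorted_dec_prod_nonneg[OF dec that])
  have F: "F k (p / 2) \<le> F k (q / 2) powr (p / q)"
    "F k (p / 2) = F k (q / 2) powr (p / q) \<Longrightarrow> (F k (q / 4))\<^sup>2 = F k (q / 2)" if k: "k \<le> m" for k
  proof -
    obtain c where c: "\<And>t. 0 < t \<Longrightarrow> t \<le> q / 2 \<Longrightarrow> F k t \<le> c"
      using sandwich_top_prod_bounded[OF A B k] dec unfolding F_def by metis
    have double: "(F k t)\<^sup>2 \<le> F k (2 * t)" for t
      unfolding F_def by (rule sandwich_top_prod_double[OF A B dec dec k])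
    have mid: "(F k ((s + t) / 2))\<^sup>2 \<le> F k s * F k t" for s t
      unfolding F_def by (rule sandwich_top_prod_midpoint[OF A B dec dec dec k])
    have pq: "0 < p / 2" "p / 2 < q / 2" using q by auto
    show "F k (p / 2) \<le> F k (q / 2) powr (p / q)"
      using midpoint_log_convex_equality(1)[OF pq F0[OF k] double mid c] by simp
    show "(F k (q / 4))\<^sup>2 = F k (q / 2)" if "F k (p / 2) = F k (q / 2) powr (p / q)"
      using midpoint_log_convex_equality(2)[OF pq F0[OF k] double mid c] that by simp
  qed
  define a where "a r i = d (r / 2) i powr (1 / r)" for r i
  have norm: "N (mpow m (mpow m A (r/2) * mpow m B r * mpow m A (r/2)) (1/r)) = N (dmat m (a r))"
    if "0 < r" for r
  proof -
    have "mpow m A (r/2) * mpow m B r * mpow m A (r/2) = ?H (r / 2)" by (simp add: sandwich_def)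
    then have "spectral_dec m (mpow m (mpow m A (r/2) * mpow m B r * mpow m A (r/2)) (1/r)) (U (r/2)) (a r)"
      using spectral_dec_mpow[OF sorted_decD(1)[OF dec[of "r/2"]], of "1/r"] unfolding a_def by simp
    then show ?thesis using norm_unitary_conj[OF N] by (simp add: spectral_dec_def)
  qed
  have amono: "antimono_on {..<m} (a r)" if "0 < r" for r
    using dmono[of "r / 2"] d0 that by (auto simp: a_def monotone_on_def intro!: powr_mono2)
  have aprod: "(\<Prod>i<k. a r i) = F k (r / 2) powr (1 / r)" if "k \<le> m" for k r
    unfolding a_def F_def by (rule prod_powr_nonneg) (use d0 that in auto)
  have ale: "(\<Prod>i<k. a p i) \<le> (\<Prod>i<k. a q i)" if k: "k \<le> m" for k
  proof -
    have "F k (p / 2) powr (1 / p) \<le> (F k (q / 2) powr (p / q)) powr (1 / p)"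
      using F(1)[OF k] F0[OF k] q by (intro powr_mono2) auto
    then show ?thesis using q by (simp add: aprod[OF k] powr_powr)
  qed
  have aeq: "\<forall>i<m. a p i = a q i"
    by (rule strictly_increasing_norm_log_majorize_eq[OF N assms(4) amono amono _ _ ale])
      (use q assms(7) norm in \<open>auto simp: a_def\<close>)
  have Feq: "(F k (q / 4))\<^sup>2 = F k (q / 2)" if k: "k \<le> m" for k
  proof (rule F(2)[OF k])
    have "F k (p / 2) powr (1 / p) = F k (q / 2) powr (1 / q)"
      using aeq k by (simp flip: aprod[OF k])
    then have "(F k (p / 2) powr (1 / p)) powr p = (F k (q / 2) powr (1 / q)) powr p" by simp
    then show "F k (p / 2) = F k (q / 2) powr (p / q)"
      using q F0[OF k] by (simp add: powr_powr)
  qed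
  \<comment> \<open>Vanishing eigenvalues prevent cancelling the equal products. Instead
    log-majorization is used in both directions: a disagreement would make one sum strictly smaller,
    against the reverse inequality.\<close>
  have sq: "(d (q / 4) i)\<^sup>2 = d (q / 2) i" if "i < m" for i
  proof (rule ccontr)
    assume "(d (q / 4) i)\<^sup>2 \<noteq> d (q / 2) i"
    then have ne: "\<exists>i<m. (d (q / 4) i)\<^sup>2 \<noteq> d (q / 2) i" using that by blast
    have prods: "(\<Prod>i<k. (d (q / 4) i)\<^sup>2) = (\<Prod>i<k. d (q / 2) i)" if "k \<le> m" for k
      using Feq[OF that] by (simp add: F_def prod_power_distrib)
    have mono: "antimono_on {..<m} (\<lambda>i. (d (q / 4) i)\<^sup>2)"
      using dmono[of "q / 4"] d0 by (auto simp: monotone_on_def intro!: power_mono)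
    have "(\<Sum>i<m. (d (q / 4) i)\<^sup>2) < (\<Sum>i<m. d (q / 2) i)"
      by (rule log_majorize_imp_sum_le(2)[OF mono _ _ _ ne]) (use d0 prods in auto)
    moreover have "(\<Sum>i<m. d (q / 2) i) \<le> (\<Sum>i<m. (d (q / 4) i)\<^sup>2)"
      by (rule log_majorize_imp_sum_le(1)[OF dmono]) (use d0 prods in auto)
    ultimately show False by simp
  qed
  let ?A = "\<lambda>r. mpow m A r" and ?B = "\<lambda>r. mpow m B r"
  note dims[simp] = mpow_dims[OF A B] and mult[simp] = mpow_mult_left[OF A B]
  let ?C = "?A (q / 2)" and ?E = "?B (q / 2)"
  \<comment> \<open>The eigenvalue sum at \<open>q / 2\<close> is the trace of
    \<open>C E E C\<close>; the sum of squares at \<open>q / 4\<close> becomes, after moving factors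
    cyclically, the trace of \<open>C E C E\<close>.\<close>
  have "(\<Sum>i<m. (?C * (?E * (?E * ?C))) $$ (i,i)) = (\<Sum>i<m. ?H (q / 2) $$ (i,i))"
    by (simp add: sandwich_def mat_assoc)
  also have "\<dots> = (\<Sum>i<m. complex_of_real (d (q / 2) i))"
    by (rule trace_spectral[OF sorted_decD(1)[OF dec]])
  also have "\<dots> = (\<Sum>i<m. complex_of_real (d (q / 4) i powr 2))"
    using sq d0 by (intro sum.cong) (auto simp: powr_numeral)
  also have "\<dots> = (\<Sum>i<m. mpow m (?H (q / 4)) 2 $$ (i,i))"
    by (rule trace_spectral[OF spectral_dec_mpow[OF sorted_decD(1)[OF dec]], symmetric])
  also have "mpow m (?H (q / 4)) 2 = ?H (q / 4) * ?H (q / 4)"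
    using mpow_mult[OF sandwich_psd[OF A B], of "q / 4" 1 1] mpow_one[OF sandwich_psd[OF A B]] by simp
  also have "\<dots> = ?A (q / 4) * (?E * (?C * (?E * ?A (q / 4))))"
    by (simp add: sandwich_def mat_assoc)
  also have "(\<Sum>i<m. \<dots> $$ (i,i)) = (\<Sum>i<m. (?E * (?C * (?E * ?A (q / 4))) * ?A (q / 4)) $$ (i,i))"
    by (rule trace_mult_commute) (auto intro!: mult_carrier_mat[of _ m m])
  also have "?E * (?C * (?E * ?A (q / 4))) * ?A (q / 4) = ?E * (?C * (?E * ?C))"
    by (simp add: mat_assoc mpow_mult[OF A])
  also have "(\<Sum>i<m. \<dots> $$ (i,i)) = (\<Sum>i<m. (?C * (?E * ?C) * ?E) $$ (i,i))"
    by (rule trace_mult_commute) (auto intro!: mult_carrier_mat[of _ m m])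
  also have "?C * (?E * ?C) * ?E = ?C * (?E * (?C * ?E))"
    by (simp add: mat_assoc)
  finally have "?C * ?E = ?E * ?C"
    by (intro commute_of_trace_eq[of _ m]) auto
  then show ?thesis using q by (intro commute_of_mpow_commute[OF A B, of "q / 2"]) auto
qed

end
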